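(* Let $E_1,E_2$ be isogenous complex elliptic curves without complex multiplication, $X=E_1\times E_2$, and $d$ the minimal degree of an isogeny $E_1\to E_2$. Then $X$ carries no irreducible principal polarization if and only if $d=1$, or $d$ is an idoneal number with $d\equiv 2,4,6 \pmod 8$ (i.e. $d$ even, idoneal, and not divisible by $8$).
   Context: A principal polarization on $X$ is an ample line bundle class $L$ with $L^2=2$; it is reducible if $L\equiv E_1'+E_2'$ with elliptic curves $E_1',E_2'$, $E_1'\cdot E_2'=1$, irreducible otherwise. Idoneal numbers (Euler's numeri idonei) are characterized (Grube) as follows: an integer $n\ge1$ is idoneal iff for every $B\in\{1,\dots,\lfloor\sqrt{n/3}\rfloor\}$ and every representation $n+B^2=AC$ with $2B\le A\le C$ and $\gcd(A,2B,C)=1$, one has $A=C$ or $A=2B$. *)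

theory Defs
  imports "HOL-Analysis.Analysis"
begin

definition lat :: "complex \<Rightarrow> complex \<Rightarrow> complex set" where
  "lat w1 w2 = {of_int m * w1 + of_int n * w2 | m n. True}"

definition has_CM :: "complex set \<Rightarrow> bool" where
  "has_CM L \<longleftrightarrow> (\<exists>\<alpha>. \<alpha> \<notin> \<int> \<and> (\<lambda>z. \<alpha> * z) ` L \<subseteq> L)"

text \<open>Isogenies C/L1 -> C/L2 are exactly the maps induced by z -> alpha z, alpha nonzero,
  alpha L1 in L2; the degree is the index of alpha L1 in L2.\<close>
definition is_isogeny :: "complex set \<Rightarrow> complex set \<Rightarrow> complex \<Rightarrow> bool" where
  "is_isogeny L1 L2 \<alpha> \<longleftrightarrow> \<alpha> \<noteq> 0 \<and> (\<lambda>z. \<alpha> * z) ` L1 \<subseteq> L2"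

definition isogenous :: "complex set \<Rightarrow> complex set \<Rightarrow> bool" where
  "isogenous L1 L2 \<longleftrightarrow> (\<exists>\<alpha>. is_isogeny L1 L2 \<alpha>)"

definition isog_deg :: "complex set \<Rightarrow> complex set \<Rightarrow> complex \<Rightarrow> nat" where
  "isog_deg L1 L2 \<alpha> = card ((\<lambda>x. (\<lambda>z. x + z) ` ((\<lambda>z. \<alpha> * z) ` L1)) ` L2)"

definition min_isog_deg :: "complex set \<Rightarrow> complex set \<Rightarrow> nat" where
  "min_isog_deg L1 L2 = (LEAST n. \<exists>\<alpha>. is_isogeny L1 L2 \<alpha> \<and> isog_deg L1 L2 \<alpha> = n)"

type_synonym cc = "complex \<times> complex"

definition cJ :: "cc \<Rightarrow> cc" where
  "cJ p = (\<i> * fst p, \<i> * snd p)"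

definition csmul :: "complex \<Rightarrow> cc \<Rightarrow> cc" where
  "csmul z p = (z * fst p, z * snd p)"

definition rcoord :: "cc \<Rightarrow> nat \<Rightarrow> real" where
  "rcoord p k = (if k = 0 then Re (fst p) else if k = 1 then Im (fst p)
                 else if k = 2 then Re (snd p) else Im (snd p))"

definition det4 :: "(nat \<Rightarrow> cc) \<Rightarrow> real" where
  "det4 v = (\<Sum>p | p permutes {0..<4::nat}. of_int (sign p) * (\<Prod>i<4. rcoord (v i) (p i)))"

text \<open>Line bundle classes (NS(X), Appell--Humbert): real alternating forms E on C^2 with
  E(iu,iv) = E(u,v) and integral on the lattice.\<close>
definition riemann_form :: "cc set \<Rightarrow> (cc \<Rightarrow> cc \<Rightarrow> real) \<Rightarrow> bool" where
  "riemann_form \<Lambda> E \<longleftrightarrow> bilinear E \<and> (\<forall>u v. E v u = - E u v)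
     \<and> (\<forall>u v. E (cJ u) (cJ v) = E u v) \<and> (\<forall>x\<in>\<Lambda>. \<forall>y\<in>\<Lambda>. E x y \<in> \<int>)"

text \<open>Pfaffian w.r.t. the standard real basis; multiplied by the covolume c of Lambda it is
  the Pfaffian w.r.t. any oriented lattice basis.\<close>
definition pf_std :: "(cc \<Rightarrow> cc \<Rightarrow> real) \<Rightarrow> real" where
  "pf_std E = (let s1 = (1,0); s2 = (\<i>,0); s3 = (0,1); s4 = (0,\<i>) in
      E s1 s2 * E s3 s4 - E s1 s3 * E s2 s4 + E s1 s4 * E s2 s3)"

definition int_num :: "real \<Rightarrow> (cc \<Rightarrow> cc \<Rightarrow> real) \<Rightarrow> (cc \<Rightarrow> cc \<Rightarrow> real) \<Rightarrow> real" where
  "int_num c E F = c * pf_std (\<lambda>x y. E x y + F x y) - c * pf_std E - c * pf_std F"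

definition ample :: "(cc \<Rightarrow> cc \<Rightarrow> real) \<Rightarrow> bool" where
  "ample E \<longleftrightarrow> (\<forall>u. u \<noteq> 0 \<longrightarrow> E (cJ u) u > 0)"

definition principal_pol :: "cc set \<Rightarrow> real \<Rightarrow> (cc \<Rightarrow> cc \<Rightarrow> real) \<Rightarrow> bool" where
  "principal_pol \<Lambda> c E \<longleftrightarrow> riemann_form \<Lambda> E \<and> ample E \<and> int_num c E E = 2"

text \<open>NS class of an elliptic curve W/(W \<inter> Lambda) in X, W a complex line such that
  W \<inter> Lambda = Za + Zb, b = z a with Im z > 0 (complex orientation); Poincare dual class.\<close>
definition elliptic_curve_class :: "cc set \<Rightarrow> real \<Rightarrow> (cc \<Rightarrow> cc \<Rightarrow> real) \<Rightarrow> bool" where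
  "elliptic_curve_class \<Lambda> c E \<longleftrightarrow>
     (\<exists>w a b z. w \<noteq> 0 \<and> a \<noteq> 0 \<and>
        (let W = range (\<lambda>t. csmul t w) in
          a \<in> W \<inter> \<Lambda> \<and> b \<in> W \<inter> \<Lambda> \<and>
          W \<inter> \<Lambda> = {of_int m *\<^sub>R a + of_int n *\<^sub>R b | m n. True}) \<and>
        b = csmul z a \<and> Im z > 0 \<and>
        E = (\<lambda>x y. - det4 (\<lambda>i. [a, b, x, y] ! i) / c))"

definition reducible_pp :: "cc set \<Rightarrow> real \<Rightarrow> (cc \<Rightarrow> cc \<Rightarrow> real) \<Rightarrow> bool" where
  "reducible_pp \<Lambda> c E \<longleftrightarrow> principal_pol \<Lambda> c E \<and>
     (\<exists>F G. elliptic_curve_class \<Lambda> c F \<and> elliptic_curve_class \<Lambda> c G \<and>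
            E = (\<lambda>x y. F x y + G x y) \<and> int_num c F G = 1)"

definition irreducible_pp :: "cc set \<Rightarrow> real \<Rightarrow> (cc \<Rightarrow> cc \<Rightarrow> real) \<Rightarrow> bool" where
  "irreducible_pp \<Lambda> c E \<longleftrightarrow> principal_pol \<Lambda> c E \<and> \<not> reducible_pp \<Lambda> c E"

section \<open>Idoneal numbers (Grube's criterion)\<close>

definition idoneal :: "nat \<Rightarrow> bool" where
  "idoneal n \<longleftrightarrow> n \<ge> 1 \<and>
     (\<forall>B::nat. 1 \<le> B \<and> real B \<le> sqrt (real n / 3) \<longrightarrow>
       (\<forall>A C::nat. n + B^2 = A * C \<and> 2 * B \<le> A \<and> A \<le> C \<and> gcd A (gcd (2 * B) C) = 1
           \<longrightarrow> A = C \<or> A = 2 * B))"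

end

theory Submission
  imports Defs "HOL-Computational_Algebra.Nth_Powers"
begin

text \<open>Choose bases such that the generator \<open>\<mu>\<close> of \<open>Hom(E\<^sub>1, E\<^sub>2)\<close> is diagonal with entries \<open>1, d\<close>.
  Then \<open>NS(X)\<close> consists of integer triples \<open>(a, b, k)\<close> with self-intersection \<open>2(ab - dk\<^sup>2)\<close>: principal
  polarizations are the solutions of \<open>ab = 1 + dk\<^sup>2\<close> with \<open>a > 0\<close>, and a reducible one is a sum of two
  isotropic triples. To \<open>(a, b, k)\<close> attach the binary quadratic form \<open>(a, 2dk, db)\<close> of determinant
  \<open>d\<close>: the polarization is reducible iff this form is diagonalizable over the integers by a
  unimodular substitution. For even \<open>d\<close> every properly primitive form of determinant \<open>d\<close> arises,
  so all polarizations are reducible iff every reduced form \<open>(A, 2B, C)\<close> has \<open>B = 0\<close>. This is Grube's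
  criterion once the ambiguous forms with \<open>A = C\<close> or \<open>A = 2B\<close> are excluded, which exist iff \<open>8\<close>
  divides \<open>d\<close>. For odd \<open>d > 1\<close> the triple \<open>(2, (d + 1)/2, 1)\<close> is irreducible.\<close>

section \<open>Reduction of binary quadratic forms\<close>

text \<open>The form attached to \<open>(a, b, k)\<close> is the equation
  \<open>ab - dk\<^sup>2 = 1\<close> multiplied by \<open>d\<close>, that is
  \<open>a(db) - (dk)\<^sup>2 = d\<close>. Its first coefficient is prime to \<open>d\<close> and
  the other two are divisible by \<open>d\<close>. Conversely, a properly primitive form represents
  a number prime to \<open>d\<close>; with that number as first coefficient, a translation makes the
  middle coefficient divisible by \<open>d\<close>, and then the determinant does the same for the
  last one. Evenness of \<open>d\<close> is what rules out improperly primitive forms. If a class of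
  self-intersection 2 is a sum of two isotropic classes, it meets each of them in 1. Irreducibility
  can therefore be tested on integers: no isotropic class may meet the polarization in 1. A class
  that does so leaves an isotropic complement, and the square roots that parametrize the two classes
  are the entries of a diagonalizing matrix.\<close>

lemma nearest_multiple:
  fixes a h :: int
  assumes "a > 0"
  obtains j where "2 * \<bar>h - a * j\<bar> \<le> a"
proof
  have "2 * h + a = 2 * a * ((2 * h + a) div (2 * a)) + (2 * h + a) mod (2 * a)"
    by simp
  moreover have "0 \<le> (2 * h + a) mod (2 * a)" "(2 * h + a) mod (2 * a) < 2 * a"
    using assms by auto
  ultimately show "2 * \<bar>h - a * ((2 * h + a) div (2 * a))\<bar> \<le> a"
    by (simp add: abs_if algebra_simps)
qed

text \<open>Gauss reduction: a translation makes the middle coefficient at most the first in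
  absolute value; if the last coefficient is then smaller than the first, exchanging the two lowers
  the first and the induction applies. The given form is expressed through the reduced one so that
  its coefficients can be unfolded later.\<close>

lemma form_reduction:
  fixes a h c :: int
  assumes "a > 0" "a * c - h\<^sup>2 > 0"
  shows "\<exists>A B C \<alpha> \<beta> \<gamma> \<delta>. \<alpha> * \<delta> - \<beta> * \<gamma> = 1 \<and> A > 0 \<and> 2 * \<bar>B\<bar> \<le> A \<and> A \<le> C
    \<and> a = A * \<alpha>\<^sup>2 + 2 * B * \<alpha> * \<gamma> + C * \<gamma>\<^sup>2
    \<and> h = A * \<alpha> * \<beta> + B * (\<alpha> * \<delta> + \<beta> * \<gamma>) + C * \<gamma> * \<delta>
    \<and> c = A * \<beta>\<^sup>2 + 2 * B * \<beta> * \<delta> + C * \<delta>\<^sup>2"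
  using assms
proof (induction "nat a" arbitrary: a h c rule: less_induct)
  case less
  obtain j where j: "2 * \<bar>h - a * j\<bar> \<le> a"
    using nearest_multiple less.prems(1) by blast
  define h' where "h' = h - a * j"
  define c' where "c' = c - 2 * h * j + a * j\<^sup>2"
  have h: "h = h' + a * j" and c: "c = c' + 2 * h' * j + a * j\<^sup>2"
    by (auto simp: h'_def c'_def algebra_simps power2_eq_square)
  have det: "a * c' - h'\<^sup>2 > 0"
    using less.prems(2) unfolding h c by (simp add: algebra_simps power2_eq_square)
  show ?case
  proof (cases "a \<le> c'")
    case True
    have "a = a * 1\<^sup>2 + 2 * h' * 1 * 0 + c' * 0\<^sup>2" "h = a * 1 * j + h' * (1 * 1 + j * 0) + c' * 0 * 1"
      "c = a * j\<^sup>2 + 2 * h' * j * 1 + c' * 1\<^sup>2"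
      by (simp_all add: h c)
    moreover have "1 * 1 - j * 0 = 1"
      by simp
    ultimately show ?thesis
      using True less.prems(1) j[folded h'_def]
      by (intro exI[of _ a] exI[of _ h'] exI[of _ c'] exI[of _ 1] exI[of _ j] exI[of _ 0] conjI)
  next
    case False
    have "a * c' > 0"
      using det by (smt (verit) zero_le_power2)
    then have "c' > 0"
      using less.prems(1) by (simp add: zero_less_mult_iff)
    moreover have "nat c' < nat a"
      using False \<open>c' > 0\<close> by simp
    moreover have "c' * a - (- h')\<^sup>2 > 0"
      using det by (simp add: mult.commute)
    ultimately obtain A B C \<alpha> \<beta> \<gamma> \<delta> where R: "\<alpha> * \<delta> - \<beta> * \<gamma> = 1" "A > 0" "2 * \<bar>B\<bar> \<le> A" "A \<le> C"
      "c' = A * \<alpha>\<^sup>2 + 2 * B * \<alpha> * \<gamma> + C * \<gamma>\<^sup>2"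
      "- h' = A * \<alpha> * \<beta> + B * (\<alpha> * \<delta> + \<beta> * \<gamma>) + C * \<gamma> * \<delta>"
      "a = A * \<beta>\<^sup>2 + 2 * B * \<beta> * \<delta> + C * \<delta>\<^sup>2"
      using less.hyps[of c' a "- h'"] by blast
    have h'': "h' = - (A * \<alpha> * \<beta> + B * (\<alpha> * \<delta> + \<beta> * \<gamma>) + C * \<gamma> * \<delta>)"
      using R(6) by simp
    \<comment> \<open>Undoing the exchange turns the columns into
      \<open>(-\<beta>, -\<delta>)\<close> and \<open>(\<alpha>, \<gamma>)\<close>; undoing the
      translation adds \<open>j\<close> times the first to the second.\<close>
    let ?\<beta> = "\<alpha> - j * \<beta>" and ?\<delta> = "\<gamma> - j * \<delta>"
    have "- \<beta> * ?\<delta> - ?\<beta> * - \<delta> = 1"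
      using R(1) by (simp add: algebra_simps)
    moreover have "a = A * (- \<beta>)\<^sup>2 + 2 * B * (- \<beta>) * (- \<delta>) + C * (- \<delta>)\<^sup>2"
      unfolding R(7) by simp
    moreover have "h = A * (- \<beta>) * ?\<beta> + B * (- \<beta> * ?\<delta> + ?\<beta> * - \<delta>) + C * (- \<delta>) * ?\<delta>"
      unfolding h h'' R(7) by (simp add: algebra_simps power2_eq_square)
    moreover have "c = A * ?\<beta>\<^sup>2 + 2 * B * ?\<beta> * ?\<delta> + C * ?\<delta>\<^sup>2"
      unfolding c h'' R(5) R(7) by (simp add: algebra_simps power2_eq_square)
    ultimately show ?thesis
      using R(2-4)
      by (intro exI[of _ A] exI[of _ B] exI[of _ C] exI[of _ "- \<beta>"] exI[of _ ?\<beta>]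
          exI[of _ "- \<delta>"] exI[of _ ?\<delta>] conjI)
  qed
qed

section \<open>Reduced forms, Grube's criterion and divisibility by 8\<close>

lemma reduced_bound:
  fixes A B C d :: int
  assumes "2 * \<bar>B\<bar> \<le> A" "A \<le> C" "A * C - B\<^sup>2 = d"
  shows "3 * B\<^sup>2 \<le> d"
proof -
  have "(2 * \<bar>B\<bar>) * (2 * \<bar>B\<bar>) \<le> A * C"
    using assms(1,2) by (intro mult_mono) auto
  then show ?thesis
    using assms(3) by (simp add: power2_eq_square)
qed

lemma dvd_8_diff_odd_squares: "8 dvd (2 * m + 1)\<^sup>2 - (2 * n + 1 :: int)\<^sup>2"
proof -
  have "even (m * (m + 1))" "even (n * (n + 1))"
    by auto
  then obtain p q where "m * (m + 1) = 2 * p" "n * (n + 1) = 2 * q"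
    by (elim evenE) blast
  then have "(2 * m + 1)\<^sup>2 - (2 * n + 1)\<^sup>2 = 8 * (p - q)"
    by (simp add: algebra_simps power2_eq_square)
  then show ?thesis
    by simp
qed

text \<open>A parity argument. Primitivity forbids \<open>A\<close> and \<open>C\<close> to be both
  even. If \<open>A = C\<close>, then \<open>d\<close> is a difference of two odd squares. If
  \<open>A = 2 * B\<close>, then \<open>C\<close> is odd and \<open>B = 2 * m\<close> is even, so
  \<open>d = 4 * m * (C - m)\<close>, where \<open>m\<close> and \<open>C - m\<close> have different
  parity.\<close>

lemma ambiguous_reduced_dvd_8:
  fixes A B C d :: int
  assumes "A * C - B\<^sup>2 = d" "even d" "gcd A (gcd (2 * B) C) = 1" "A = C \<or> A = 2 * B"
  shows "8 dvd d"
proof -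
  have ndvd: "\<not> (even A \<and> even C)"
  proof
    assume "even A \<and> even C"
    then have "2 dvd gcd A (gcd (2 * B) C)"
      by simp
    then show False
      using assms(3) by simp
  qed
  show ?thesis
    using assms(4)
  proof
    assume "A = C"
    then have "odd A"
      using ndvd by auto
    moreover from this have "odd B"
      using assms(1,2) \<open>A = C\<close> by auto
    ultimately obtain m n where "A = 2 * m + 1" "B = 2 * n + 1"
      by (auto elim!: oddE)
    then show ?thesis
      using dvd_8_diff_odd_squares[of m n] assms(1) \<open>A = C\<close> by (simp add: power2_eq_square)
  next
    assume "A = 2 * B"
    then have "odd C"
      using ndvd by auto
    have "even B"
      using assms(1,2) \<open>A = 2 * B\<close> by auto
    then obtain m n where m: "B = 2 * m" and n: "C = 2 * n + 1"
      using \<open>odd C\<close> by (auto elim!: oddE evenE)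
    have "even (m * (m - 1))"
      by auto
    then obtain q where "m * (m - 1) = 2 * q"
      by (elim evenE) blast
    then have "d = 8 * (m * n - q)"
      using assms(1) unfolding \<open>A = 2 * B\<close> m n by (simp add: algebra_simps power2_eq_square)
    then show ?thesis
      by simp
  qed
qed

lemma idoneal_reduced:
  fixes A B C :: int and d :: nat
  assumes "idoneal d" "2 * \<bar>B\<bar> \<le> A" "A \<le> C" "A * C - B\<^sup>2 = d"
    and "gcd A (gcd (2 * B) C) = 1" "B \<noteq> 0"
  shows "A = C \<or> A = 2 * \<bar>B\<bar>"
proof -
  define A' B' C' where "A' = nat A" and "B' = nat \<bar>B\<bar>" and "C' = nat C"
  have eqs: "A = int A'" "\<bar>B\<bar> = int B'" "C = int C'"
    using assms(2,3) by (auto simp: A'_def B'_def C'_def)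
  have sq: "B\<^sup>2 = (int B')\<^sup>2"
    using eqs(2) by (metis power2_abs)
  have "int (3 * B'\<^sup>2) \<le> int d"
    using reduced_bound[OF assms(2-4)] sq by simp
  then have "3 * B'\<^sup>2 \<le> d"
    by (simp only: of_nat_le_iff)
  then have "3 * (real B')\<^sup>2 \<le> real d"
    by (metis of_nat_le_iff of_nat_mult of_nat_numeral of_nat_power)
  then have "real B' \<le> sqrt (real d / 3)"
    by (intro real_le_rsqrt) simp
  moreover have "int (d + B'\<^sup>2) = int (A' * C')"
    using assms(4) sq eqs by (simp add: algebra_simps)
  then have "d + B'\<^sup>2 = A' * C'"
    by (simp only: of_nat_eq_iff)
  moreover have "gcd A' (gcd (2 * B') C') = 1"
  proof -
    have "gcd (2 * B) C = gcd (2 * \<bar>B\<bar>) C"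
      by (metis abs_mult abs_numeral gcd_abs1_int)
    then have "int (gcd A' (gcd (2 * B') C')) = 1"
      using assms(5) eqs by (simp flip: gcd_int_int_eq)
    then show ?thesis
      by simp
  qed
  moreover have "B' \<ge> 1" "2 * B' \<le> A'" "A' \<le> C'"
    using assms(2,3,6) eqs by auto
  ultimately have "A' = C' \<or> A' = 2 * B'"
    by (intro assms(1)[unfolded idoneal_def, THEN conjunct2, rule_format] conjI)
  then show ?thesis
    using eqs by auto
qed

text \<open>Read as classes, the conclusion splits \<open>(a, b, k)\<close> into the isotropic
  triples \<open>(A\<alpha>\<^sup>2, C\<beta>\<^sup>2, \<alpha>\<beta>)\<close> and
  \<open>(C\<gamma>\<^sup>2, A\<delta>\<^sup>2, \<gamma>\<delta>)\<close>; the unit determinant will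
  make both of them elliptic curves. The criterion forces the reduced form to be diagonal, and
  coprimality of \<open>A\<close> and \<open>C\<close> then allows the factor \<open>d\<close> to be
  cancelled from the last two coefficients.\<close>

lemma solution_decomposition:
  fixes a b k :: int and d :: nat
  assumes d: "d = 1 \<or> (idoneal d \<and> d mod 8 \<in> {2, 4, 6})"
    and ab: "a * b = 1 + int d * k\<^sup>2" and "a > 0"
  obtains A C \<alpha> \<beta> \<gamma> \<delta> :: int where "A > 0" "C > 0" "A * C = int d" "A * \<alpha> * \<delta> - C * \<beta> * \<gamma> = 1"
    "a = A * \<alpha>\<^sup>2 + C * \<gamma>\<^sup>2" "b = C * \<beta>\<^sup>2 + A * \<delta>\<^sup>2" "k = \<alpha> * \<beta> + \<gamma> * \<delta>"
proof -
  have d0: "d > 0"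
    using d by (auto simp: idoneal_def)
  have det: "a * (int d * b) - (int d * k)\<^sup>2 = int d"
  proof -
    have "a * (int d * b) - (int d * k)\<^sup>2 = int d * (a * b - int d * k\<^sup>2)"
      by (simp add: algebra_simps power2_eq_square)
    then show ?thesis
      using ab by simp
  qed
  obtain A B C \<alpha> \<beta> \<gamma> \<delta> where R: "\<alpha> * \<delta> - \<beta> * \<gamma> = 1" "A > 0" "2 * \<bar>B\<bar> \<le> A" "A \<le> C"
      "a = A * \<alpha>\<^sup>2 + 2 * B * \<alpha> * \<gamma> + C * \<gamma>\<^sup>2"
      "int d * k = A * \<alpha> * \<beta> + B * (\<alpha> * \<delta> + \<beta> * \<gamma>) + C * \<gamma> * \<delta>"
      "int d * b = A * \<beta>\<^sup>2 + 2 * B * \<beta> * \<delta> + C * \<delta>\<^sup>2"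
    using form_reduction[OF \<open>a > 0\<close>, of "int d * b" "int d * k"] det d0 by auto
  have det': "A * C - B\<^sup>2 = int d"
  proof -
    have "a * (int d * b) - (int d * k)\<^sup>2 = (A * C - B\<^sup>2) * (\<alpha> * \<delta> - \<beta> * \<gamma>)\<^sup>2"
      unfolding R(5-7) by (simp add: algebra_simps power2_eq_square)
    then show ?thesis
      using R(1) det by simp
  qed
  have "B = 0 \<and> coprime A C"
  proof (cases "d = 1")
    case True
    have "3 * B\<^sup>2 \<le> 1"
      using reduced_bound[OF R(3,4) det'] True by simp
    then have "B = 0"
      by (smt (verit) zero_less_power2)
    then have "A * C = 1"
      using det' True by simp
    then show ?thesis
      using \<open>B = 0\<close> R(2) by (simp add: zmult_eq_1_iff)
  next
    case False
    then have ido: "idoneal d" and mod8: "d mod 8 \<in> {2, 4, 6}"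
      using d by auto
    have "even d"
      using mod8 by (auto; presburger)
    have "\<not> 8 dvd int d"
    proof -
      have "\<not> 8 dvd d"
        using mod8 by (auto simp: dvd_eq_mod_eq_0)
      then show ?thesis
        by (metis int_dvd_int_iff of_nat_numeral)
    qed
    \<comment> \<open>A common divisor \<open>g\<close> divides \<open>a\<close>, \<open>2dk\<close>
      and \<open>db\<close>. By \<open>ab - dk\<^sup>2 = 1\<close> it is prime to \<open>d\<close>,
      hence odd since \<open>d\<close> is even; so it divides \<open>k\<close> and \<open>b\<close>
      too, and therefore 1.\<close>
    have prim: "gcd A (gcd (2 * B) C) = 1"
    proof -
      define g where "g = gcd A (gcd (2 * B) C)"
      have g: "g dvd A" "g dvd 2 * B" "g dvd C"
        unfolding g_def by (auto intro: dvd_trans)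
      have ga: "g dvd a" and gk: "g dvd 2 * (int d * k)" and gb: "g dvd int d * b"
      proof -
        have "a = A * \<alpha>\<^sup>2 + 2 * B * (\<alpha> * \<gamma>) + C * \<gamma>\<^sup>2"
          "2 * (int d * k) = A * (2 * \<alpha> * \<beta>) + 2 * B * (\<alpha> * \<delta> + \<beta> * \<gamma>) + C * (2 * \<gamma> * \<delta>)"
          "int d * b = A * \<beta>\<^sup>2 + 2 * B * (\<beta> * \<delta>) + C * \<delta>\<^sup>2"
          unfolding R(5-7) by (simp_all add: algebra_simps)
        then show "g dvd a" "g dvd 2 * (int d * k)" "g dvd int d * b"
          using g by (metis dvd_add dvd_mult2)+
      qed
      have "coprime g (int d)"
      proof (rule coprimeI)
        fix e assume "e dvd g" "e dvd int d"
        then have "e dvd a * b - int d * k\<^sup>2"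
          using ga by (intro dvd_diff dvd_mult2) (auto intro: dvd_trans)
        then show "is_unit e"
          using ab by simp
      qed
      moreover have "odd g"
        using \<open>even d\<close> calculation by (meson coprime_common_divisor even_of_nat odd_one)
      ultimately have "g dvd k" "g dvd b"
        using gk gb by (auto simp: coprime_dvd_mult_right_iff)
      then have "g dvd a * b - int d * k\<^sup>2"
        by (simp add: power2_eq_square)
      then have "is_unit g"
        using ab by simp
      then show ?thesis
        unfolding g_def by simp
    qed
    have "B = 0"
    proof (rule ccontr)
      assume "B \<noteq> 0"
      then have "A = C \<or> A = 2 * \<bar>B\<bar>"
        using idoneal_reduced[OF ido R(3,4) det' prim] by simp
      moreover have "gcd A (gcd (2 * \<bar>B\<bar>) C) = 1"
        using prim by (metis abs_mult abs_numeral gcd_abs1_int)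
      ultimately have "8 dvd int d"
        using ambiguous_reduced_dvd_8[of A C "\<bar>B\<bar>" "int d"] det' \<open>even d\<close> by simp
      then show False
        using \<open>\<not> 8 dvd int d\<close> by simp
    qed
    then show ?thesis
      using prim by (simp add: coprime_iff_gcd_eq_1)
  qed
  then have B: "B = 0" and cop: "coprime A C"
    by auto
  have AC: "A * C = int d"
    using det' B by simp
  have eqk: "A * C * k = A * \<alpha> * \<beta> + C * \<gamma> * \<delta>" and eqb: "A * C * b = A * \<beta>\<^sup>2 + C * \<delta>\<^sup>2"
    using R(6,7) AC B by auto
  have "A dvd C * (\<gamma> * \<delta>)"
  proof -
    have "C * (\<gamma> * \<delta>) = A * (C * k - \<alpha> * \<beta>)"
      using eqk by (simp add: algebra_simps)
    then show ?thesis
      by simp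
  qed
  moreover have "A dvd C * \<delta>\<^sup>2"
  proof -
    have "C * \<delta>\<^sup>2 = A * (C * b - \<beta>\<^sup>2)"
      using eqb by (simp add: algebra_simps)
    then show ?thesis
      by simp
  qed
  moreover have "C dvd A * (\<alpha> * \<beta>)"
  proof -
    have "A * (\<alpha> * \<beta>) = C * (A * k - \<gamma> * \<delta>)"
      using eqk by (simp add: algebra_simps)
    then show ?thesis
      by simp
  qed
  moreover have "C dvd A * \<beta>\<^sup>2"
  proof -
    have "A * \<beta>\<^sup>2 = C * (A * b - \<delta>\<^sup>2)"
      using eqb by (simp add: algebra_simps)
    then show ?thesis
      by simp
  qed
  ultimately have dv: "A dvd \<gamma> * \<delta>" "A dvd \<delta>\<^sup>2" "C dvd \<alpha> * \<beta>" "C dvd \<beta>\<^sup>2"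
    using cop by (auto simp: coprime_dvd_mult_right_iff coprime_commute)
  \<comment> \<open>Multiplying the determinant relation by \<open>\<delta>\<close> and by
    \<open>\<beta>\<close> turns divisibility of squares and products into divisibility of
    \<open>\<delta>\<close> and \<open>\<beta>\<close> themselves.\<close>
  have "\<delta> = \<alpha> * \<delta>\<^sup>2 - \<beta> * (\<gamma> * \<delta>)" "\<beta> = \<delta> * (\<alpha> * \<beta>) - \<gamma> * \<beta>\<^sup>2"
  proof -
    have "\<delta> = \<delta> * (\<alpha> * \<delta> - \<beta> * \<gamma>)" "\<beta> = \<beta> * (\<alpha> * \<delta> - \<beta> * \<gamma>)"
      using R(1) by simp_all
    then show "\<delta> = \<alpha> * \<delta>\<^sup>2 - \<beta> * (\<gamma> * \<delta>)" "\<beta> = \<delta> * (\<alpha> * \<beta>) - \<gamma> * \<beta>\<^sup>2"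
      by (simp_all add: algebra_simps power2_eq_square)
  qed
  then have "A dvd \<delta>" "C dvd \<beta>"
    using dv by (metis dvd_diff dvd_mult)+
  then obtain \<delta>' \<beta>' where \<delta>: "\<delta> = A * \<delta>'" and \<beta>: "\<beta> = C * \<beta>'"
    by (auto elim!: dvdE)
  have "C > 0"
    using R(2,4) by simp
  have "A * C * k = A * C * (\<alpha> * \<beta>' + \<gamma> * \<delta>')" "A * C * b = A * C * (C * \<beta>'\<^sup>2 + A * \<delta>'\<^sup>2)"
    using eqk eqb unfolding \<delta> \<beta> by (simp_all add: algebra_simps power2_eq_square)
  then have "k = \<alpha> * \<beta>' + \<gamma> * \<delta>'" "b = C * \<beta>'\<^sup>2 + A * \<delta>'\<^sup>2"
    using \<open>A > 0\<close> \<open>C > 0\<close> by simp_all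
  moreover have "A * \<alpha> * \<delta>' - C * \<beta>' * \<gamma> = 1"
    using R(1) unfolding \<delta> \<beta> by (simp add: algebra_simps)
  moreover have "a = A * \<alpha>\<^sup>2 + C * \<gamma>\<^sup>2"
    using R(5) B by simp
  ultimately show ?thesis
    by (intro that[OF R(2) \<open>C > 0\<close> AC])
qed

section \<open>Principal polarizations that are not diagonalizable\<close>

text \<open>Products of the prescribed primes stand in for the Chinese remainder theorem: later
  choices only concern which of the two coordinates vanishes modulo each prime.\<close>

lemma coprime_pair_with_prime_divisors:
  fixes P Q :: "nat set"
  assumes "finite P" "finite Q" "P \<inter> Q = {}" "\<forall>p\<in>P. prime p" "\<forall>p\<in>Q. prime p"
  obtains X Y :: int where "coprime X Y"
    "\<And>p. prime p \<Longrightarrow> int p dvd X \<longleftrightarrow> p \<in> P" "\<And>p. prime p \<Longrightarrow> int p dvd Y \<longleftrightarrow> p \<in> Q"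
proof -
  have *: "int p dvd int (\<Prod>R) \<longleftrightarrow> p \<in> R"
    if "finite R" "\<forall>q\<in>R. prime q" "prime p" for p and R :: "nat set"
  proof -
    have "p dvd \<Prod>R \<longleftrightarrow> p \<in> R"
      using that by (simp add: prime_dvd_prod_iff) (metis dvd_refl primes_dvd_imp_eq)
    then show ?thesis
      by (simp only: int_dvd_int_iff)
  qed
  have "coprime (\<Prod>P) (\<Prod>Q)"
    using assms by (intro prod_coprime_left prod_coprime_right) (auto intro: primes_coprime)
  then have "coprime (int (\<Prod>P)) (int (\<Prod>Q))"
    by (simp only: coprime_int_iff)
  then show ?thesis
    using that * assms by blast
qed

lemma coprime_complete:
  fixes X Y :: int
  assumes "coprime X Y"
  obtains U V where "X * V - Y * U = 1"
proof -
  obtain p q where "p * X + q * Y = 1"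
    using assms bezout_int[of X Y] by auto
  then show ?thesis
    using that[of p "- q"] by (simp add: algebra_simps)
qed

lemma not_coprime_int_prime:
  fixes a b :: int
  assumes "\<not> coprime a b" "a \<noteq> 0 \<or> b \<noteq> 0"
  obtains p :: nat where "prime p" "int p dvd a" "int p dvd b"
proof -
  have "nat (gcd a b) \<noteq> 1"
    using assms(1) by (auto simp: coprime_iff_gcd_eq_1)
  then obtain p where "prime p" "p dvd nat (gcd a b)"
    using prime_factor_nat by blast
  then have "int p dvd gcd a b"
    by (metis gcd_ge_0_int int_dvd_int_iff int_nat_eq)
  then show ?thesis
    using that \<open>prime p\<close> by auto
qed

text \<open>Modulo each prime dividing \<open>m\<close> the choice of \<open>X\<close> and
  \<open>Y\<close> leaves a single term of the form, \<open>A * X\<^sup>2\<close>,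
  \<open>C * Y\<^sup>2\<close> or \<open>2 * B * X * Y\<close>, and proper primitivity guarantees
  that one of the coefficients survives.\<close>

lemma primitive_form_represents_coprime:
  fixes A B C m :: int
  assumes prim: "gcd A (gcd (2 * B) C) = 1" and "m \<noteq> 0"
  obtains X Y where "coprime X Y" "coprime (A * X\<^sup>2 + 2 * B * X * Y + C * Y\<^sup>2) m"
proof -
  define S where "S = {p::nat. prime p \<and> int p dvd m}"
  have "finite S"
  proof (rule finite_subset)
    show "S \<subseteq> {p. p dvd nat \<bar>m\<bar>}"
      by (auto simp: S_def)
    show "finite {p. p dvd nat \<bar>m\<bar>}"
      using \<open>m \<noteq> 0\<close> by (intro finite_divisors_nat) auto
  qed
  \<comment> \<open>Primes in \<open>Q\<close> are to divide \<open>Y\<close> and those in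
    \<open>P\<close> are to divide \<open>X\<close>; the remaining primes of \<open>S\<close> divide
    both \<open>A\<close> and \<open>C\<close> and are to divide neither coordinate.\<close>
  define Q where "Q = {p\<in>S. \<not> int p dvd A}"
  define P where "P = {p\<in>S. int p dvd A \<and> \<not> int p dvd C}"
  obtain X Y where cop: "coprime X Y" and X: "\<And>p. prime p \<Longrightarrow> int p dvd X \<longleftrightarrow> p \<in> P"
    and Y: "\<And>p. prime p \<Longrightarrow> int p dvd Y \<longleftrightarrow> p \<in> Q"
  proof (rule coprime_pair_with_prime_divisors)
    show "finite P" "finite Q"
      using \<open>finite S\<close> by (simp_all add: P_def Q_def)
    show "P \<inter> Q = {}" "\<forall>p\<in>P. prime p" "\<forall>p\<in>Q. prime p"
      by (auto simp: P_def Q_def S_def)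
  qed blast
  let ?f = "A * X\<^sup>2 + 2 * B * X * Y + C * Y\<^sup>2"
  have "coprime ?f m"
  proof (rule ccontr)
    assume "\<not> coprime ?f m"
    then obtain p where p: "prime p" "int p dvd ?f" "int p dvd m"
      using \<open>m \<noteq> 0\<close> by (elim not_coprime_int_prime) auto
    have prime: "prime (int p)"
      using p(1) by simp
    have "p \<in> S"
      using p by (simp add: S_def)
    consider "\<not> int p dvd A" | "int p dvd A" "\<not> int p dvd C" | "int p dvd A" "int p dvd C"
      by blast
    then show False
    proof cases
      case 1
      then have "int p dvd Y" "\<not> int p dvd X"
        using X[OF p(1)] Y[OF p(1)] \<open>p \<in> S\<close> by (auto simp: P_def Q_def)
      moreover have "A * X\<^sup>2 = ?f - Y * (2 * B * X + C * Y)"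
        by (simp add: algebra_simps power2_eq_square)
      ultimately have "int p dvd A * X\<^sup>2"
        using p(2) by (metis dvd_diff dvd_mult2)
      then show False
        using 1 \<open>\<not> int p dvd X\<close> prime by (simp add: prime_dvd_mult_iff prime_dvd_power_iff)
    next
      case 2
      then have "int p dvd X" "\<not> int p dvd Y"
        using X[OF p(1)] Y[OF p(1)] \<open>p \<in> S\<close> by (auto simp: P_def Q_def)
      moreover have "C * Y\<^sup>2 = ?f - X * (2 * B * Y + A * X)"
        by (simp add: algebra_simps power2_eq_square)
      ultimately have "int p dvd C * Y\<^sup>2"
        using p(2) by (metis dvd_diff dvd_mult2)
      then show False
        using 2 \<open>\<not> int p dvd Y\<close> prime by (simp add: prime_dvd_mult_iff prime_dvd_power_iff)
    next
      case 3
      then have "\<not> int p dvd X" "\<not> int p dvd Y"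
        using X[OF p(1)] Y[OF p(1)] by (auto simp: P_def Q_def)
      moreover have "\<not> int p dvd 2 * B"
      proof
        assume "int p dvd 2 * B"
        then have "int p dvd gcd A (gcd (2 * B) C)"
          using 3 by simp
        then show False
          using prim p(1) by simp
      qed
      moreover have "(2 * B) * X * Y = ?f - A * X\<^sup>2 - C * Y\<^sup>2"
        by simp
      then have "int p dvd (2 * B) * X * Y"
        using p(2) 3 by (metis dvd_diff dvd_mult2)
      ultimately show False
        using prime by (simp add: prime_dvd_mult_iff)
    qed
  qed
  then show ?thesis
    using that cop by blast
qed

section \<open>Isotropic classes and diagonal forms\<close>

lemma coprime_mult_square:
  fixes x y z :: int
  assumes "coprime x y" "x \<ge> 0" "y \<ge> 0" "x * y = z\<^sup>2"
  obtains s t where "x = s\<^sup>2" "y = t\<^sup>2" "z = s * t"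
proof -
  have "nat x * nat y = (nat \<bar>z\<bar>)\<^sup>2"
    using assms by (simp flip: nat_mult_distrib nat_power_eq)
  then have "is_square (nat x * nat y)"
    by (metis is_nth_power_def)
  moreover have "coprime (nat x) (nat y)"
    using assms by (metis coprime_int_iff int_nat_eq)
  ultimately have "is_square (nat x)" "is_square (nat y)"
    by (auto simp: is_nth_power_mult_coprime_nat_iff)
  then obtain s t where "nat x = s\<^sup>2" "nat y = t\<^sup>2"
    by (auto simp: is_nth_power_def)
  then have st: "x = (int s)\<^sup>2" "y = (int t)\<^sup>2"
    using assms(2,3) by (metis int_nat_eq of_nat_power)+
  then have "(int s * int t)\<^sup>2 = z\<^sup>2"
    using assms(4) by (simp add: power_mult_distrib)
  then have "z = int s * int t \<or> z = (- int s) * int t"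
    by (auto simp: power2_eq_iff)
  then show ?thesis
    using that[of "int s" "int t"] that[of "- int s" "int t"] st by auto
qed

text \<open>Parametrizes isotropic triples with coprime \<open>x\<close> and \<open>y\<close>. The
  factor \<open>d1 = gcd x d\<close> goes to \<open>x\<close> and the rest of \<open>d\<close> to
  \<open>y\<close>; after cancelling, the product of two coprime numbers is a square.\<close>

lemma coprime_mult_eq_mult_square:
  fixes x y z d :: int
  assumes "coprime x y" "x \<ge> 0" "y \<ge> 0" "x * y = d * z\<^sup>2" "d > 0"
  obtains d1 d2 s t where "d1 > 0" "d2 > 0" "d1 * d2 = d" "x = d1 * s\<^sup>2" "y = d2 * t\<^sup>2" "z = s * t"
proof -
  define d1 where "d1 = gcd x d"
  have "d1 > 0"
    using assms(5) by (simp add: d1_def)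
  obtain x1 d2 where x1: "x = d1 * x1" and d2: "d = d1 * d2" and "coprime x1 d2"
    using gcd_coprime_exists[of x d] \<open>d1 > 0\<close> unfolding d1_def by (metis less_irrefl mult.commute)
  have "d2 > 0"
    using assms(5) \<open>d1 > 0\<close> unfolding d2 by (simp add: zero_less_mult_iff)
  have "d1 * (x1 * y) = d1 * (d2 * z\<^sup>2)"
    using assms(4) unfolding x1 d2 by (simp add: mult.assoc)
  then have eq: "x1 * y = d2 * z\<^sup>2"
    using \<open>d1 > 0\<close> by simp
  then have "d2 dvd y"
    using \<open>coprime x1 d2\<close> by (metis coprime_commute coprime_dvd_mult_right_iff dvd_triv_left)
  then obtain y1 where y1: "y = d2 * y1"
    by (elim dvdE)
  have "x1 * y1 = z\<^sup>2"
    using eq \<open>d2 > 0\<close> unfolding y1 by simp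
  moreover have "coprime x1 y1"
    using assms(1) unfolding x1 y1 by simp
  moreover have "x1 \<ge> 0" "y1 \<ge> 0"
    using assms(2,3) \<open>d1 > 0\<close> \<open>d2 > 0\<close> unfolding x1 y1 by (auto simp: zero_le_mult_iff)
  ultimately obtain s t where "x1 = s\<^sup>2" "y1 = t\<^sup>2" "z = s * t"
    using coprime_mult_square by blast
  then show ?thesis
    using that[of d1 d2 s t] \<open>d1 > 0\<close> \<open>d2 > 0\<close> x1 y1 d2 by simp
qed

text \<open>The mixed term costs at most \<open>A * |x * y|\<close>, so the value is at least
  \<open>A\<close> times \<open>x\<^sup>2 + y\<^sup>2 - |x * y|\<close>, which is a positive
  integer.\<close>

lemma reduced_form_ge:
  fixes A B C x y :: int
  assumes "2 * \<bar>B\<bar> \<le> A" "A \<le> C" "x \<noteq> 0 \<or> y \<noteq> 0"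
  shows "A * x\<^sup>2 + 2 * B * x * y + C * y\<^sup>2 \<ge> A"
proof -
  have pos: "x\<^sup>2 + y\<^sup>2 - \<bar>x * y\<bar> \<ge> 1"
  proof -
    have "2 * (x\<^sup>2 + y\<^sup>2 - \<bar>x * y\<bar>) = x\<^sup>2 + y\<^sup>2 + (\<bar>x\<bar> - \<bar>y\<bar>)\<^sup>2"
      by (simp add: power2_eq_square algebra_simps abs_mult)
    moreover have "x\<^sup>2 + y\<^sup>2 > 0"
      using assms(3) by (simp add: sum_power2_gt_zero_iff)
    ultimately show ?thesis
      by (smt (verit) zero_le_power2)
  qed
  have "A \<ge> 0"
    using assms(1) by simp
  have "\<bar>2 * B * x * y\<bar> = 2 * \<bar>B\<bar> * \<bar>x * y\<bar>"
    by (simp add: abs_mult)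
  also have "\<dots> \<le> A * \<bar>x * y\<bar>"
    using assms(1) by (intro mult_right_mono) auto
  finally have "2 * B * x * y \<ge> - (A * \<bar>x * y\<bar>)"
    by linarith
  moreover have "A * y\<^sup>2 \<le> C * y\<^sup>2"
    using assms(2) by (intro mult_right_mono) auto
  moreover have "A * 1 \<le> A * (x\<^sup>2 + y\<^sup>2 - \<bar>x * y\<bar>)"
    using pos \<open>A \<ge> 0\<close> by (rule mult_left_mono)
  ultimately show ?thesis
    by (simp add: algebra_simps)
qed

text \<open>Since \<open>d1\<close> and \<open>d2\<close> are values of the reduced form, both are
  at least its minimum \<open>A\<close>. But
  \<open>A = d1 * \<alpha>\<^sup>2 + d2 * \<gamma>\<^sup>2\<close>, so whichever of them occurs here
  with nonzero coefficient equals \<open>A\<close>. Each term of \<open>B\<close> is then zero or a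
  multiple of \<open>A\<close>.\<close>

lemma reduced_form_diagonal:
  fixes A B C d1 d2 \<alpha> \<beta> \<gamma> \<delta> :: int
  assumes red: "2 * \<bar>B\<bar> \<le> A" "A \<le> C" and d: "d1 > 0" "d2 > 0" and det: "\<alpha> * \<delta> - \<beta> * \<gamma> = 1"
    and A: "A = d1 * \<alpha>\<^sup>2 + d2 * \<gamma>\<^sup>2" and B: "B = d1 * \<alpha> * \<beta> + d2 * \<gamma> * \<delta>"
    and C: "C = d1 * \<beta>\<^sup>2 + d2 * \<delta>\<^sup>2"
  shows "A dvd B"
proof -
  have nz: "\<gamma> \<noteq> 0 \<or> \<delta> \<noteq> 0" "\<alpha> \<noteq> 0 \<or> \<beta> \<noteq> 0"
    using det by auto
  \<comment> \<open>The columns \<open>(\<delta>, -\<gamma>)\<close> and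
    \<open>(-\<beta>, \<alpha>)\<close> of the inverse matrix are where the reduced form takes the
    values \<open>d1\<close> and \<open>d2\<close>.\<close>
  have "d1 * (\<alpha> * \<delta> - \<beta> * \<gamma>)\<^sup>2 = A * \<delta>\<^sup>2 + 2 * B * \<delta> * (- \<gamma>) + C * (- \<gamma>)\<^sup>2"
    "d2 * (\<alpha> * \<delta> - \<beta> * \<gamma>)\<^sup>2 = A * (- \<beta>)\<^sup>2 + 2 * B * (- \<beta>) * \<alpha> + C * \<alpha>\<^sup>2"
    unfolding A B C by (simp_all add: algebra_simps power2_eq_square)
  then have ge: "d1 \<ge> A" "d2 \<ge> A"
    using reduced_form_ge[OF red, of \<delta> "- \<gamma>"] reduced_form_ge[OF red, of "- \<beta>" \<alpha>] nz det by auto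
  have "d1 * \<alpha>\<^sup>2 \<ge> 0" "d2 * \<gamma>\<^sup>2 \<ge> 0"
    using d by auto
  have *: "d1 = A" if "\<alpha> \<noteq> 0"
  proof -
    have "d1 * 1 \<le> d1 * \<alpha>\<^sup>2"
      using d that by (intro mult_left_mono) (auto simp: int_one_le_iff_zero_less)
    then show ?thesis
      using A ge \<open>d2 * \<gamma>\<^sup>2 \<ge> 0\<close> by simp
  qed
  have **: "d2 = A" if "\<gamma> \<noteq> 0"
  proof -
    have "d2 * 1 \<le> d2 * \<gamma>\<^sup>2"
      using d that by (intro mult_left_mono) (auto simp: int_one_le_iff_zero_less)
    then show ?thesis
      using A ge \<open>d1 * \<alpha>\<^sup>2 \<ge> 0\<close> by simp
  qed
  have "A dvd d1 * (\<alpha> * \<beta>)" "A dvd d2 * (\<gamma> * \<delta>)"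
    using * ** by (cases "\<alpha> = 0"; cases "\<gamma> = 0"; simp)+
  then show ?thesis
    unfolding B by (simp add: mult.assoc)
qed

text \<open>A principal polarization \<open>(a, b, k)\<close> is reducible iff some isotropic class \<open>(x, y, z)\<close> has
  intersection number \<open>1\<close> with it. In that case the quadratic form \<open>(a, 2dk, db)\<close> of determinant
  \<open>d\<close> is diagonalizable over the integers.\<close>

lemma isotropic_unit_imp_diagonal:
  fixes a b k d x y z :: int
  assumes "d > 0" "a > 0" "b > 0" and ab: "a * b = 1 + d * k\<^sup>2"
    and xy: "x * y = d * z\<^sup>2" and one: "x * b + y * a - 2 * d * k * z = 1"
  obtains d1 d2 \<alpha> \<beta> \<gamma> \<delta> where "d1 > 0" "d2 > 0" "\<alpha> * \<delta> - \<beta> * \<gamma> = 1"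
    "a = d1 * \<alpha>\<^sup>2 + d2 * \<gamma>\<^sup>2" "d * k = d1 * \<alpha> * \<beta> + d2 * \<gamma> * \<delta>" "d * b = d1 * \<beta>\<^sup>2 + d2 * \<delta>\<^sup>2"
proof -
  have "coprime x y"
  proof (rule ccontr)
    assume "\<not> coprime x y"
    moreover have "x \<noteq> 0 \<or> y \<noteq> 0"
    proof (rule ccontr)
      assume "\<not> (x \<noteq> 0 \<or> y \<noteq> 0)"
      then have "x = 0" "y = 0" by auto
      then have "2 * (- d * k * z) = 1" using one by simp
      then show False by presburger
    qed
    ultimately obtain p where p: "prime p" "int p dvd x" "int p dvd y"
      by (elim not_coprime_int_prime) auto
    then have "int p dvd d * z\<^sup>2"
      using xy by (metis dvd_mult2)
    then have "int p dvd d * z"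
      using p(1) by (auto simp: prime_dvd_mult_iff prime_dvd_power_iff)
    moreover have "x * b + y * a - (d * z) * (2 * k) = 1"
      using one by (simp add: algebra_simps)
    ultimately have "int p dvd 1"
      using p by (metis dvd_add dvd_diff dvd_mult2)
    then show False
      using p(1) by simp
  qed
  \<comment> \<open>Multiply \<open>one\<close> by \<open>b * x\<close> or by \<open>a * y\<close>
    and complete the square. The right-hand sides are nonnegative, which gives the signs of
    \<open>x\<close> and \<open>y\<close>.\<close>
  have sq: "b * x = (b * x - d * k * z)\<^sup>2 + d * z\<^sup>2" "a * y = (a * y - d * k * z)\<^sup>2 + d * z\<^sup>2"
  proof -
    have "b * x = b * x * (x * b + y * a - 2 * d * k * z)" "a * y = a * y * (x * b + y * a - 2 * d * k * z)"
      using one by simp_all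
    moreover have "b * x * (x * b + y * a - 2 * d * k * z) = (b * x)\<^sup>2 + (a * b) * (x * y) - 2 * d * k * z * (b * x)"
      "a * y * (x * b + y * a - 2 * d * k * z) = (a * y)\<^sup>2 + (a * b) * (x * y) - 2 * d * k * z * (a * y)"
      by (simp_all add: algebra_simps power2_eq_square)
    ultimately show "b * x = (b * x - d * k * z)\<^sup>2 + d * z\<^sup>2" "a * y = (a * y - d * k * z)\<^sup>2 + d * z\<^sup>2"
      unfolding ab xy by (simp_all add: algebra_simps power2_eq_square)
  qed
  have "b * x \<ge> 0"
    by (subst sq(1)) (use \<open>d > 0\<close> in auto)
  moreover have "a * y \<ge> 0"
    by (subst sq(2)) (use \<open>d > 0\<close> in auto)
  ultimately have "x \<ge> 0" "y \<ge> 0"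
    using \<open>a > 0\<close> \<open>b > 0\<close> by (auto simp: zero_le_mult_iff)
  then obtain d1 d2 s t where D: "d1 > 0" "d2 > 0" "d1 * d2 = d" "x = d1 * s\<^sup>2" "y = d2 * t\<^sup>2" "z = s * t"
    using coprime_mult_eq_mult_square[OF \<open>coprime x y\<close> _ _ xy \<open>d > 0\<close>] by blast
  \<comment> \<open>The complement \<open>(a - x, b - y, k - z)\<close> is isotropic as well and
    turns out to be \<open>(d2 * u\<^sup>2, d1 * v\<^sup>2, - u * v)\<close>. The diagonalizing
    matrix has columns \<open>(s, u)\<close> and \<open>(d2 * t, - d1 * v)\<close>.\<close>
  define u v where "u = d1 * k * s - a * t" and "v = d2 * k * t - b * s"
  have one': "d1 * s\<^sup>2 * b + d2 * t\<^sup>2 * a - 2 * (d1 * d2) * k * (s * t) = 1"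
    using one D by simp
  have ab': "a * b = 1 + d1 * d2 * k\<^sup>2"
    using ab D by simp
  show ?thesis
  proof (rule that[of d1 d2 s "- d1 * v" "d2 * t" u])
    show "d1 > 0" "d2 > 0"
      by fact+
    have "s * (- d1 * v) - d2 * t * u = d1 * s\<^sup>2 * b + d2 * t\<^sup>2 * a - 2 * (d1 * d2) * k * (s * t)"
      unfolding u_def v_def by (simp add: algebra_simps power2_eq_square)
    then show "s * (- d1 * v) - d2 * t * u = 1"
      using one' by simp
    \<comment> \<open>Multiples of the relations \<open>one'\<close> and \<open>ab'\<close>, both
      zero, are added so that the equation becomes a polynomial identity; the same device serves
      \<open>b\<close> and \<open>k\<close> below.\<close>
    have "d1 * s\<^sup>2 + d2 * u\<^sup>2 = a + a * (d1 * s\<^sup>2 * b + d2 * t\<^sup>2 * a - 2 * (d1 * d2) * k * (s * t) - 1)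
        - d1 * s\<^sup>2 * (a * b - (1 + d1 * d2 * k\<^sup>2))"
      unfolding u_def by (simp add: algebra_simps power2_eq_square)
    then show "a = d1 * s\<^sup>2 + d2 * u\<^sup>2"
      using one' ab' by simp
    have "d1 * (d2 * t)\<^sup>2 + d2 * (- d1 * v)\<^sup>2 = d1 * d2 * (d2 * t\<^sup>2 + d1 * v\<^sup>2)"
      by (simp add: algebra_simps power2_eq_square)
    also have "d2 * t\<^sup>2 + d1 * v\<^sup>2 = b + b * (d1 * s\<^sup>2 * b + d2 * t\<^sup>2 * a - 2 * (d1 * d2) * k * (s * t) - 1)
        - d2 * t\<^sup>2 * (a * b - (1 + d1 * d2 * k\<^sup>2))"
      unfolding v_def by (simp add: algebra_simps power2_eq_square)
    also have "\<dots> = b"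
      using one' ab' by simp
    finally show "d * b = d1 * (d2 * t)\<^sup>2 + d2 * (- d1 * v)\<^sup>2"
      using D(3) by simp
    have "d1 * s * (d2 * t) + d2 * u * (- d1 * v) = d1 * d2 * (s * t - u * v)"
      by (simp add: algebra_simps)
    also have "s * t - u * v = k + k * (d1 * s\<^sup>2 * b + d2 * t\<^sup>2 * a - 2 * (d1 * d2) * k * (s * t) - 1)
        - s * t * (a * b - (1 + d1 * d2 * k\<^sup>2))"
      unfolding u_def v_def by (simp add: algebra_simps power2_eq_square)
    also have "\<dots> = k"
      using one' ab' by simp
    finally show "d * k = d1 * s * (d2 * t) + d2 * u * (- d1 * v)"
      using D(3) by simp
  qed
qed

text \<open>\<open>x * b + y * a - 2 * d * k * z\<close> is the intersection number of
  \<open>(x, y, z)\<close> with \<open>(a, b, k)\<close>. Forbidding the value 1 on isotropic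
  classes excludes every splitting without mentioning lattices.\<close>

definition irreducible_triple :: "int \<Rightarrow> int \<Rightarrow> int \<Rightarrow> int \<Rightarrow> bool" where
  "irreducible_triple d a b k \<longleftrightarrow> a > 0 \<and> a * b = 1 + d * k\<^sup>2 \<and>
     \<not> (\<exists>x y z. x * y = d * z\<^sup>2 \<and> x * b + y * a - 2 * d * k * z = 1)"

text \<open>The attached form is equivalent to \<open>(2, 2, (d + 1)/2)\<close>, an ambiguous form
  that Grube's criterion tolerates. An isotropic class of intersection number 1 would satisfy
  \<open>(x - 1)\<^sup>2 + d * (x - 2 * z)\<^sup>2 = 1\<close>, hence \<open>x = 2 * z\<close> with
  \<open>x\<close> equal to 0 or 2; both are impossible by parity.\<close>

lemma irreducible_triple_odd:
  fixes d :: int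
  assumes "odd d" "d > 1"
  shows "irreducible_triple d 2 ((1 + d) div 2) 1"
proof -
  define b where "b = (1 + d) div 2"
  have b: "2 * b = 1 + d"
    using assms(1) by (simp add: b_def)
  have False if xy: "x * y = d * z\<^sup>2" and one: "x * b + y * 2 - 2 * d * 1 * z = 1" for x y z
  proof -
    have "x * (2 * b) + 4 * y - 4 * d * z = 2"
      using one by simp
    then have "x * (x * (1 + d) + 4 * y - 4 * d * z) = x * 2"
      unfolding b by simp
    then have "x\<^sup>2 * (1 + d) + 4 * (x * y) - 4 * d * z * x = 2 * x"
      by (simp add: algebra_simps power2_eq_square)
    then have eq: "(x - 1)\<^sup>2 + d * (x - 2 * z)\<^sup>2 = 1"
      unfolding xy by (simp add: algebra_simps power2_eq_square)
    have "x - 2 * z = 0"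
    proof (rule ccontr)
      assume "x - 2 * z \<noteq> 0"
      then have "1 \<le> (x - 2 * z)\<^sup>2"
        by (simp add: int_one_le_iff_zero_less)
      then have "d * 1 \<le> d * (x - 2 * z)\<^sup>2"
        using assms(2) by (intro mult_left_mono) auto
      then show False
        using eq assms(2) by (smt (verit) zero_le_power2)
    qed
    then have "x = 2 * z" "(x - 1)\<^sup>2 = 1"
      using eq by auto
    then have "x = 0 \<and> z = 0 \<or> x = 2 \<and> z = 1"
      by (auto simp: power2_eq_1_iff)
    then show False
    proof
      assume "x = 0 \<and> z = 0"
      then have "2 * y = 1"
        using one by simp
      then show False
        by presburger
    next
      assume "x = 2 \<and> z = 1"
      then show False
        using xy assms(1) by auto
    qed
  qed
  then show ?thesis
    using b unfolding irreducible_triple_def b_def by auto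
qed

text \<open>A unimodular substitution gives the form the shape \<open>(a, 2dk, db)\<close>, from
  which the triple is read off. An isotropic class of intersection number 1 would make this form,
  and with it the reduced one, diagonalizable; then \<open>A\<close> would divide \<open>B\<close>,
  although \<open>0 < B < A\<close>.\<close>

lemma irreducible_triple_reduced_form:
  fixes A B C d :: int
  assumes red: "0 < B" "2 * B \<le> A" "A \<le> C" and det: "A * C - B\<^sup>2 = d" and "d > 0"
    and prim: "gcd A (gcd (2 * B) C) = 1"
  shows "\<exists>a b k. irreducible_triple d a b k"
proof -
  obtain X Y where cop: "coprime X Y" and cop_d: "coprime (A * X\<^sup>2 + 2 * B * X * Y + C * Y\<^sup>2) d"
    using primitive_form_represents_coprime[OF prim] \<open>d > 0\<close> by (metis less_irrefl)
  define a where "a = A * X\<^sup>2 + 2 * B * X * Y + C * Y\<^sup>2"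
  obtain U0 V0 where UV0: "X * V0 - Y * U0 = 1"
    using coprime_complete[OF cop] by blast
  define h0 where "h0 = A * X * U0 + B * (X * V0 + Y * U0) + C * Y * V0"
  obtain p q where pq: "p * a + q * d = 1"
    using cop_d bezout_int[of a d] unfolding a_def by auto
  \<comment> \<open>\<open>p\<close> inverts \<open>a\<close> modulo \<open>d\<close>. Adding
    \<open>j\<close> times the first column to the second moves \<open>h0\<close> to
    \<open>h0 * (1 - a * p) = h0 * q * d\<close>.\<close>
  define j where "j = - (h0 * p)"
  define U V where "U = U0 + j * X" and "V = V0 + j * Y"
  have UV: "X * V - Y * U = 1"
    using UV0 unfolding U_def V_def by (simp add: algebra_simps)
  define k where "k = h0 * q"
  define c where "c = A * U\<^sup>2 + 2 * B * U * V + C * V\<^sup>2"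
  have h: "d * k = A * X * U + B * (X * V + Y * U) + C * Y * V"
  proof -
    have "A * X * U + B * (X * V + Y * U) + C * Y * V = h0 + j * a"
      unfolding h0_def U_def V_def a_def by (simp add: algebra_simps power2_eq_square)
    also have "\<dots> = h0 * (p * a + q * d) + j * a"
      using pq by simp
    also have "\<dots> = d * k"
      by (simp add: j_def k_def algebra_simps)
    finally show ?thesis by simp
  qed
  have ac: "a * c - (d * k)\<^sup>2 = d"
  proof -
    have "a * c - (d * k)\<^sup>2 = (A * C - B\<^sup>2) * (X * V - Y * U)\<^sup>2"
      unfolding h a_def c_def by (simp add: algebra_simps power2_eq_square)
    then show ?thesis
      using det UV by simp
  qed
  have "a * c = d * (1 + d * k\<^sup>2)"
    using ac by (simp add: algebra_simps power2_eq_square)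
  then have "d dvd c"
    using cop_d unfolding a_def[symmetric] by (metis coprime_commute coprime_dvd_mult_right_iff dvd_triv_left)
  then obtain b where c: "c = d * b"
    by (elim dvdE)
  have ab: "a * b = 1 + d * k\<^sup>2"
    using \<open>a * c = d * (1 + d * k\<^sup>2)\<close> \<open>d > 0\<close> unfolding c by simp
  have XY: "X \<noteq> 0 \<or> Y \<noteq> 0"
    using UV by auto
  have "a > 0"
    using reduced_form_ge[of B A C X Y] red XY unfolding a_def by simp
  have "a * b > 0"
    using ab \<open>d > 0\<close> by (smt (verit) mult_nonneg_nonneg zero_le_power2)
  then have "b > 0"
    using \<open>a > 0\<close> by (simp add: zero_less_mult_iff)
  have False if xy: "x * y = d * z\<^sup>2" and one: "x * b + y * a - 2 * d * k * z = 1" for x y z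
  proof -
    obtain d1 d2 \<alpha> \<beta> \<gamma> \<delta> where D: "d1 > 0" "d2 > 0" "\<alpha> * \<delta> - \<beta> * \<gamma> = 1"
      "a = d1 * \<alpha>\<^sup>2 + d2 * \<gamma>\<^sup>2" "d * k = d1 * \<alpha> * \<beta> + d2 * \<gamma> * \<delta>" "d * b = d1 * \<beta>\<^sup>2 + d2 * \<delta>\<^sup>2"
      by (rule isotropic_unit_imp_diagonal[OF \<open>d > 0\<close> \<open>a > 0\<close> \<open>b > 0\<close> ab xy one])
    \<comment> \<open>The diagonalizing matrix times the inverse of the matrix with columns
      \<open>(X, Y)\<close> and \<open>(U, V)\<close>; it diagonalizes the reduced form
      itself.\<close>
    let ?\<alpha> = "\<alpha> * V - \<beta> * Y" and ?\<beta> = "\<beta> * X - \<alpha> * U" and ?\<gamma> = "\<gamma> * V - \<delta> * Y" and ?\<delta> = "\<delta> * X - \<gamma> * U"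
    have A: "A = a * V\<^sup>2 - 2 * (d * k) * V * Y + c * Y\<^sup>2"
      and B: "B = - (a * U * V) + d * k * (X * V + Y * U) - c * X * Y"
      and C: "C = a * U\<^sup>2 - 2 * (d * k) * U * X + c * X\<^sup>2"
    proof -
      have "a * V\<^sup>2 - 2 * (d * k) * V * Y + c * Y\<^sup>2 = A * (X * V - Y * U)\<^sup>2"
        "- (a * U * V) + d * k * (X * V + Y * U) - c * X * Y = B * (X * V - Y * U)\<^sup>2"
        "a * U\<^sup>2 - 2 * (d * k) * U * X + c * X\<^sup>2 = C * (X * V - Y * U)\<^sup>2"
        unfolding h a_def c_def by (simp_all add: algebra_simps power2_eq_square)
      then show "A = a * V\<^sup>2 - 2 * (d * k) * V * Y + c * Y\<^sup>2"
        "B = - (a * U * V) + d * k * (X * V + Y * U) - c * X * Y"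
        "C = a * U\<^sup>2 - 2 * (d * k) * U * X + c * X\<^sup>2"
        using UV by simp_all
    qed
    have "A dvd B"
    proof (rule reduced_form_diagonal[of B A C d1 d2 ?\<alpha> ?\<delta> ?\<beta> ?\<gamma>])
      show "2 * \<bar>B\<bar> \<le> A" "A \<le> C" "d1 > 0" "d2 > 0"
        using red D by auto
      have "?\<alpha> * ?\<delta> - ?\<beta> * ?\<gamma> = (\<alpha> * \<delta> - \<beta> * \<gamma>) * (X * V - Y * U)"
        by (simp add: algebra_simps)
      then show "?\<alpha> * ?\<delta> - ?\<beta> * ?\<gamma> = 1"
        using D(3) UV by simp
      show "A = d1 * ?\<alpha>\<^sup>2 + d2 * ?\<gamma>\<^sup>2"
        unfolding A c D(6) D(5) D(4) by (simp add: algebra_simps power2_eq_square)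
      show "B = d1 * ?\<alpha> * ?\<beta> + d2 * ?\<gamma> * ?\<delta>"
        unfolding B c D(6) D(5) D(4) by (simp add: algebra_simps power2_eq_square)
      show "C = d1 * ?\<beta>\<^sup>2 + d2 * ?\<delta>\<^sup>2"
        unfolding C c D(6) D(5) D(4) by (simp add: algebra_simps power2_eq_square)
    qed
    then show False
      using red zdvd_imp_le[of A B] by simp
  qed
  then have "irreducible_triple d a b k"
    using \<open>a > 0\<close> ab unfolding irreducible_triple_def by blast
  then show ?thesis
    by blast
qed

lemma irreducible_triple_exists:
  fixes d :: nat
  assumes "d > 0" "\<not> (d = 1 \<or> (idoneal d \<and> d mod 8 \<in> {2, 4, 6}))"
  shows "\<exists>a b k. irreducible_triple (int d) a b k"
proof (cases "even d")
  case False
  then show ?thesis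
    using irreducible_triple_odd[of "int d"] assms by auto
next
  case True
  \<comment> \<open>Multiples of 8 carry an ambiguous reduced form \<open>(A, 2B, C)\<close>: for
    \<open>8m\<close> it is \<open>(4, 4, 1 + 2m)\<close>, which has \<open>A \<le> C\<close> only
    from \<open>m = 2\<close> on, and for 8 itself it is \<open>(3, 2, 3)\<close>.\<close>
  consider "d = 8" | m where "d = 8 * m" "m \<ge> 2" | "\<not> idoneal d"
  proof (cases "8 dvd d")
    case True
    then obtain m where "d = 8 * m"
      by (elim dvdE)
    then show ?thesis
      using that assms(1) by (cases "m = 1") auto
  next
    case False
    then have "d mod 8 \<in> {2, 4, 6}"
      using \<open>even d\<close> by (simp; presburger)
    then show ?thesis
      using that assms(2) by blast
  qed
  then show ?thesis
  proof cases
    case 1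
    show ?thesis
      by (rule irreducible_triple_reduced_form[of 1 3 3]) (use 1 in \<open>auto simp: gcd_non_0_int\<close>)
  next
    case 2
    have "gcd 4 (1 + 2 * int m) = 1"
    proof -
      have "coprime (2 ^ 2) (1 + 2 * int m)"
        by (subst coprime_power_left_iff) simp
      then show ?thesis
        by (simp add: coprime_iff_gcd_eq_1)
    qed
    then have "gcd 4 (gcd (2 * 2) (1 + 2 * int m)) = 1"
      by simp
    then show ?thesis
      by (intro irreducible_triple_reduced_form[of 2 4 "1 + 2 * int m"]) (use 2 in auto)
  next
    case 3
    then obtain A B C where B: "1 \<le> B" "d + B\<^sup>2 = A * C" "2 * B \<le> A" "A \<le> C" "gcd A (gcd (2 * B) C) = 1"
      using assms(1) unfolding idoneal_def by auto
    have "int d + (int B)\<^sup>2 = int A * int C"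
      using B(2) by (metis of_nat_add of_nat_mult of_nat_power)
    moreover have "gcd (int A) (gcd (2 * int B) (int C)) = 1"
      using B(5) by (metis gcd_int_int_eq of_nat_1 of_nat_mult of_nat_numeral)
    ultimately show ?thesis
      by (intro irreducible_triple_reduced_form[of "int B" "int A" "int C"]) (use B(1,3,4) assms(1) in auto)
  qed
qed

section \<open>Hermitian forms on the plane\<close>

text \<open>The imaginary part of the Hermitian form whose matrix has rows \<open>(p, r)\<close> and
  \<open>(cnj r, q)\<close>. The determinant of this matrix is the Pfaffian, and ampleness is its
  positive definiteness.\<close>

definition hform :: "real \<Rightarrow> real \<Rightarrow> complex \<Rightarrow> cc \<Rightarrow> cc \<Rightarrow> real" where
  "hform p q r u v = Im (of_real p * fst u * cnj (fst v) + of_real q * snd u * cnj (snd v)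
     + r * fst u * cnj (snd v) + cnj r * snd u * cnj (fst v))"

lemma cc_basis_expansion:
  "(u :: cc) = Re (fst u) *\<^sub>R (1, 0) + Im (fst u) *\<^sub>R (\<i>, 0) + Re (snd u) *\<^sub>R (0, 1) + Im (snd u) *\<^sub>R (0, \<i>)"
  by (simp add: prod_eq_iff complex_eq_iff)

lemma hform_alternating: "hform p q r v u = - hform p q r u v"
  by (simp add: hform_def algebra_simps)

lemma hform_cJ: "hform p q r (cJ u) (cJ v) = hform p q r u v"
  by (simp add: hform_def cJ_def algebra_simps)

lemma bilinear_hform: "bilinear (hform p q r)"
  unfolding bilinear_def
  by (auto intro!: linearI simp: hform_def algebra_simps)

lemma hform_add: "hform (p + p') (q + q') (r + r') u v = hform p q r u v + hform p' q' r' u v"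
  by (simp add: hform_def algebra_simps)

lemma hform_scale: "hform (t * p) (t * q) (of_real t * r) u v = t * hform p q r u v"
  by (simp add: hform_def algebra_simps)

lemma hform_inject:
  assumes "hform p q r = hform p' q' r'"
  shows "p = p'" "q = q'" "r = r'"
proof -
  have eq: "hform p q r u v = hform p' q' r' u v" for u v
    using assms by simp
  show "p = p'" "q = q'" "r = r'"
    using eq[of "(\<i>, 0)" "(1, 0)"] eq[of "(0, \<i>)" "(0, 1)"] eq[of "(1, 0)" "(0, 1)"] eq[of "(\<i>, 0)" "(0, 1)"]
    by (auto simp: hform_def complex_eq_iff)
qed

text \<open>Invariance under \<open>cJ\<close> reduces the six values on pairs of standard basis
  vectors to four, which are the real parameters \<open>p\<close>, \<open>q\<close>,
  \<open>Re r\<close> and \<open>Im r\<close>.\<close>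

lemma hermitian_imp_hform:
  assumes "bilinear E" and alt: "\<And>u v. E v u = - E u v" and J: "\<And>u v. E (cJ u) (cJ v) = E u v"
  obtains p q r where "E = hform p q r"
proof
  let ?s1 = "(1, 0) :: cc" and ?s2 = "(\<i>, 0) :: cc" and ?s3 = "(0, 1) :: cc" and ?s4 = "(0, \<i>) :: cc"
  note bl = bilinear_ladd[OF assms(1)] bilinear_radd[OF assms(1)] bilinear_lmul[OF assms(1)]
    bilinear_rmul[OF assms(1)]
  have diag: "E s s = 0" for s
    using alt[of s s] by simp
  have neg: "E u (- v) = - E u v" for u v
    using bilinear_rneg[OF assms(1)] by simp
  have e24: "E ?s2 ?s4 = E ?s1 ?s3" and e23: "E ?s2 ?s3 = - E ?s1 ?s4"
    using J[of ?s1 ?s3] J[of ?s1 ?s4] neg[of ?s2 ?s3] by (auto simp: cJ_def)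
  show "E = hform (- E ?s1 ?s2) (- E ?s3 ?s4) (Complex (- E ?s1 ?s4) (E ?s1 ?s3))"
  proof (intro ext)
    fix u v
    show "E u v = hform (- E ?s1 ?s2) (- E ?s3 ?s4) (Complex (- E ?s1 ?s4) (E ?s1 ?s3)) u v"
      apply (subst (1) cc_basis_expansion[of u], subst (1) cc_basis_expansion[of v])
      apply (simp only: bl diag e24 e23 alt[of ?s2 ?s1] alt[of ?s3 ?s1] alt[of ?s4 ?s1] alt[of ?s3 ?s2]
          alt[of ?s4 ?s2] alt[of ?s4 ?s3])
      apply (simp add: hform_def algebra_simps)
      done
  qed
qed

lemma pf_std_hform: "pf_std (hform p q r) = p * q - (cmod r)\<^sup>2"
  unfolding cmod_power2 by (simp add: pf_std_def hform_def power2_eq_square)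

lemma int_num_hform_self: "int_num c (hform p q r) (hform p q r) = 2 * c * (p * q - (cmod r)\<^sup>2)"
proof -
  have "(\<lambda>x y. hform p q r x y + hform p q r x y) = hform (p + p) (q + q) (r + r)"
    by (intro ext) (simp only: hform_add)
  then show ?thesis
    by (simp add: int_num_def pf_std_hform cmod_power2 algebra_simps)
qed

lemma ample_hform:
  assumes "p * q - (cmod r)\<^sup>2 > 0"
  shows "ample (hform p q r) \<longleftrightarrow> p > 0"
proof
  assume "ample (hform p q r)"
  then have "hform p q r (cJ (1, 0)) (1, 0) > 0"
    unfolding ample_def by (rule allE[of _ "(1, 0)"]) (simp add: zero_prod_def)
  then show "p > 0"
    by (simp add: hform_def cJ_def)
next
  assume "p > 0"
  show "ample (hform p q r)"
    unfolding ample_def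
  proof (intro allI impI)
    fix u :: cc
    assume "u \<noteq> 0"
    \<comment> \<open>Completing the square in the first variable, as in Sylvester's
      criterion.\<close>
    have eq: "p * hform p q r (cJ u) u
      = (cmod (of_real p * fst u + cnj r * snd u))\<^sup>2 + (p * q - (cmod r)\<^sup>2) * (cmod (snd u))\<^sup>2"
      by (simp add: hform_def cJ_def cmod_power2) (simp add: algebra_simps power2_eq_square)
    have "p * hform p q r (cJ u) u > 0"
    proof (cases "snd u = 0")
      case True
      then have "fst u \<noteq> 0"
        using \<open>u \<noteq> 0\<close> by (simp add: prod_eq_iff)
      then show ?thesis
        unfolding eq using True \<open>p > 0\<close> by simp
    next
      case False
      then show ?thesis
        unfolding eq using assms by (intro add_nonneg_pos) auto
    qed
    then show "hform p q r (cJ u) u > 0"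
      using \<open>p > 0\<close> by (simp add: zero_less_mult_iff)
  qed
qed

section \<open>Classes of complex lines as degenerate Hermitian forms\<close>

lemma det4_expand:
  "det4 v = (let m = (\<lambda>i j. rcoord (v i) j) in
     (m 0 0 * m 1 1 - m 0 1 * m 1 0) * (m 2 2 * m 3 3 - m 2 3 * m 3 2)
   - (m 0 0 * m 1 2 - m 0 2 * m 1 0) * (m 2 1 * m 3 3 - m 2 3 * m 3 1)
   + (m 0 0 * m 1 3 - m 0 3 * m 1 0) * (m 2 1 * m 3 2 - m 2 2 * m 3 1)
   + (m 0 1 * m 1 2 - m 0 2 * m 1 1) * (m 2 0 * m 3 3 - m 2 3 * m 3 0)
   - (m 0 1 * m 1 3 - m 0 3 * m 1 1) * (m 2 0 * m 3 2 - m 2 2 * m 3 0)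
   + (m 0 2 * m 1 3 - m 0 3 * m 1 2) * (m 2 0 * m 3 1 - m 2 1 * m 3 0))"
proof -
  have set: "{0..<4::nat} = insert 0 (insert 1 (insert 2 {3}))"
    by auto
  have fin: "finite {1, 2, 3::nat}" "0 \<notin> {1, 2, 3::nat}" "finite {2, 3::nat}" "1 \<notin> {2, 3::nat}"
    "finite {3::nat}" "2 \<notin> {3::nat}"
    by auto
  have prod: "(\<Prod>i<4. g i) = g 0 * g 1 * g 2 * g (3::nat)" for g :: "nat \<Rightarrow> real"
    by (simp add: eval_nat_numeral)
  show ?thesis
    unfolding det4_def set sum_over_permutations_insert[OF fin(1,2)]
      sum_over_permutations_insert[OF fin(3,4)] sum_over_permutations_insert[OF fin(5,6)] permutes_sing prod
    by (simp add: sign_swap_id permutation_swap_id permutation_compose sign_compose sign_id transpose_def Let_def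
        algebra_simps)
qed

text \<open>For nonzero \<open>a\<close> this functional identifies the quotient of the plane by the
  complex line through \<open>a\<close> with the complex numbers.\<close>

definition wedge :: "cc \<Rightarrow> cc \<Rightarrow> complex" where
  "wedge a x = fst a * snd x - snd a * fst x"

lemma det4_line:
  "det4 (\<lambda>i. [a, csmul z a, x, y] ! i) = Im z * Im (cnj (wedge a x) * wedge a y)"
  unfolding det4_expand Let_def
  by (simp add: rcoord_def csmul_def wedge_def numeral_2_eq_2 numeral_3_eq_3) (simp add: algebra_simps)

text \<open>By \<open>det4_line\<close> the form is pulled back along the complex functional
  \<open>wedge a\<close>, so it is Hermitian of rank at most one. Its determinant vanishes, which is
  why elliptic curves are isotropic.\<close>

lemma det4_line_hform:
  "(\<lambda>x y. - det4 (\<lambda>i. [a, csmul z a, x, y] ! i) / c)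
    = hform (Im z * (cmod (snd a))\<^sup>2 / c) (Im z * (cmod (fst a))\<^sup>2 / c) (- of_real (Im z / c) * snd a * cnj (fst a))"
proof (intro ext)
  fix x y
  have "- (Im z * Im (cnj (wedge a x) * wedge a y)) / c = (Im z / c) * (- Im (cnj (wedge a x) * wedge a y))"
    by (simp only: times_divide_eq_left mult_minus_right)
  also have "\<dots> = (Im z / c) * hform ((cmod (snd a))\<^sup>2) ((cmod (fst a))\<^sup>2) (- snd a * cnj (fst a)) x y"
    by (simp add: wedge_def hform_def cmod_power2) (simp add: algebra_simps power2_eq_square)
  also have "\<dots> = hform (Im z / c * (cmod (snd a))\<^sup>2) (Im z / c * (cmod (fst a))\<^sup>2)
      (of_real (Im z / c) * (- snd a * cnj (fst a))) x y"
    by (simp only: hform_scale)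
  finally show "- det4 (\<lambda>i. [a, csmul z a, x, y] ! i) / c
    = hform (Im z * (cmod (snd a))\<^sup>2 / c) (Im z * (cmod (fst a))\<^sup>2 / c) (- of_real (Im z / c) * snd a * cnj (fst a)) x y"
    by (simp add: det4_line mult.assoc)
qed

section \<open>Lattices and the Neron--Severi group\<close>

lemma of_int_combination_in_lat: "of_int m * w1 + of_int n * w2 \<in> lat w1 w2"
  unfolding lat_def by blast

lemma lat_closed:
  assumes "x \<in> lat w1 w2" "y \<in> lat w1 w2"
  shows "of_int m * x + of_int n * y \<in> lat w1 w2"
proof -
  obtain a b a' b' where "x = of_int a * w1 + of_int b * w2" "y = of_int a' * w1 + of_int b' * w2"
    using assms unfolding lat_def by blast
  then have "of_int m * x + of_int n * y = of_int (m * a + n * a') * w1 + of_int (m * b + n * b') * w2"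
    by (simp add: algebra_simps)
  then show ?thesis
    by (simp only: of_int_combination_in_lat)
qed

lemma lat_generators: "w1 \<in> lat w1 w2" "w2 \<in> lat w1 w2"
  using of_int_combination_in_lat[of 1 w1 0 w2] of_int_combination_in_lat[of 0 w1 1 w2] by simp_all

lemma lat_eqI:
  assumes "u \<in> lat w1 w2" "v \<in> lat w1 w2" "w1 \<in> lat u v" "w2 \<in> lat u v"
  shows "lat u v = lat w1 w2"
proof -
  have "lat x y \<subseteq> lat z w" if "x \<in> lat z w" "y \<in> lat z w" for x y z w
    using lat_closed[OF that] by (auto simp: lat_def[of x y])
  then show ?thesis
    using assms by blast
qed

lemma image_mult_lat: "(\<lambda>z. \<nu> * z) ` lat w1 w2 = lat (\<nu> * w1) (\<nu> * w2)"
proof (intro equalityI subsetI)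
  have dist: "\<nu> * (of_int m * w1 + of_int n * w2) = of_int m * (\<nu> * w1) + of_int n * (\<nu> * w2)" for m n
    by (simp add: algebra_simps)
  show "x \<in> lat (\<nu> * w1) (\<nu> * w2)" if "x \<in> (\<lambda>z. \<nu> * z) ` lat w1 w2" for x
    using that of_int_combination_in_lat[of _ "\<nu> * w1" _ "\<nu> * w2"] by (auto simp: lat_def[of w1 w2] dist)
  show "x \<in> (\<lambda>z. \<nu> * z) ` lat w1 w2" if x: "x \<in> lat (\<nu> * w1) (\<nu> * w2)" for x
  proof -
    obtain m n where "x = \<nu> * (of_int m * w1 + of_int n * w2)"
      using x unfolding lat_def dist by blast
    then show ?thesis
      using of_int_combination_in_lat by blast
  qed
qed

lemma Im_cnj_mult_lat:
  assumes "x \<in> lat w1 w2" "y \<in> lat w1 w2"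
  obtains n :: int where "Im (cnj x * y) = of_int n * Im (cnj w1 * w2)"
proof -
  obtain a b a' b' where xy: "x = of_int a * w1 + of_int b * w2" "y = of_int a' * w1 + of_int b' * w2"
    using assms unfolding lat_def by blast
  have "Im (cnj x * y) = of_int (a * b' - b * a') * Im (cnj w1 * w2)"
    unfolding xy by (simp add: algebra_simps)
  then show ?thesis
    using that by blast
qed

lemma basis_expansion:
  "of_real (Im (cnj w1 * w2)) * v = of_real (Im (cnj v * w2)) * w1 + of_real (Im (cnj w1 * v)) * w2"
  by (simp add: complex_eq_iff algebra_simps)

text \<open>The area pairing divided by the covolume is unimodular: by Cramer's rule
  \<open>basis_expansion\<close> the two pairings with the generators are the coordinates of
  \<open>v\<close>.\<close>

lemma lat_dual:
  assumes "Im (cnj w1 * w2) \<noteq> 0" "Im (cnj v * w2) / Im (cnj w1 * w2) \<in> \<int>"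
    "Im (cnj w1 * v) / Im (cnj w1 * w2) \<in> \<int>"
  shows "v \<in> lat w1 w2"
proof -
  let ?o = "Im (cnj w1 * w2)"
  obtain m n where mn: "Im (cnj v * w2) / ?o = of_int m" "Im (cnj w1 * v) / ?o = of_int n"
    using assms(2,3) by (auto elim!: Ints_cases)
  then have coords: "Im (cnj v * w2) = of_int m * ?o" "Im (cnj w1 * v) = of_int n * ?o"
    by (simp_all only: nonzero_divide_eq_eq[OF assms(1)])
  have "of_real ?o * v = of_real (of_int m * ?o) * w1 + of_real (of_int n * ?o) * w2"
    using basis_expansion[of w1 w2 v] by (simp only: coords)
  also have "\<dots> = of_real ?o * (of_int m * w1 + of_int n * w2)"
    by (simp only: of_real_mult of_real_of_int_eq distrib_left mult.assoc mult.left_commute)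
  finally have "of_real ?o * v = of_real ?o * (of_int m * w1 + of_int n * w2)" .
  then have "v = of_int m * w1 + of_int n * w2"
    using assms(1) by (metis mult_cancel_left of_real_eq_0_iff)
  then show ?thesis
    by (simp only: of_int_combination_in_lat)
qed

lemma Im_of_real_mult: "Im (of_real x * z) = x * Im z"
  by simp

lemma Im_cnj_mult_swap: "Im (cnj x * y) = - Im (cnj y * x)"
  by simp

lemma hform_mixed: "hform p q r (u, 0) (0, v) = Im (cnj v * (r * u))"
  unfolding hform_def by (simp add: algebra_simps)

text \<open>Normal form of a pair of isogenous curves: \<open>\<mu>\<close> sends \<open>e1\<close>
  to one generator of the second lattice and \<open>e2\<close> to \<open>d\<close> times the other.
  The absence of complex multiplication survives only as \<open>hom\<close>.\<close>

locale lattice_pair =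
  fixes e1 e2 \<mu> :: complex and d :: nat
  assumes orientation: "Im (cnj e1 * e2) > 0" and \<mu>: "\<mu> \<noteq> 0" and d: "d > 0"
    and hom: "\<And>\<nu>. (\<lambda>z. \<nu> * z) ` lat e1 e2 \<subseteq> lat (\<mu> * e1) (\<mu> * e2 / of_nat d) \<Longrightarrow> \<exists>k. \<nu> = of_int k * \<mu>"
begin

definition area1 :: real where "area1 = Im (cnj e1 * e2)"
definition area2 :: real where "area2 = Im (cnj (\<mu> * e1) * (\<mu> * e2 / of_nat d))"
definition L1 :: "complex set" where "L1 = lat e1 e2"
definition L2 :: "complex set" where "L2 = lat (\<mu> * e1) (\<mu> * e2 / of_nat d)"

text \<open>The class \<open>a[0 \<times> E\<^sub>2] + b[E\<^sub>1 \<times> 0] + k\<gamma>\<close>, where \<open>\<gamma>\<close> corresponds to the generator \<open>\<mu>\<close> of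
  \<open>Hom(E\<^sub>1, E\<^sub>2)\<close>.\<close>
definition NS :: "int \<Rightarrow> int \<Rightarrow> int \<Rightarrow> cc \<Rightarrow> cc \<Rightarrow> real" where
  "NS a b k = hform (of_int a / area1) (of_int b / area2) (of_int k * \<mu> / of_real area2)"

lemma area1_pos: "area1 > 0"
  using orientation by (simp add: area1_def)

lemma area2_eq: "area2 = (cmod \<mu>)\<^sup>2 * area1 / d"
proof -
  have "cnj (\<mu> * e1) * (\<mu> * e2 / of_nat d) = of_real ((cmod \<mu>)\<^sup>2 / d) * (cnj e1 * e2)"
    by (simp add: complex_norm_square del: of_real_power)
  then show ?thesis
    unfolding area1_def area2_def by (simp only: Im_of_real_mult) simp
qed

lemma area2_pos: "area2 > 0"
  using area1_pos \<mu> d by (simp add: area2_eq)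

lemma mu_maps: "u \<in> L1 \<Longrightarrow> \<mu> * u \<in> L2"
proof -
  assume "u \<in> L1"
  then obtain m n where "u = of_int m * e1 + of_int n * e2"
    unfolding L1_def lat_def by blast
  then have "\<mu> * u = of_int m * (\<mu> * e1) + of_int (n * int d) * (\<mu> * e2 / of_nat d)"
    using d by (simp add: algebra_simps)
  then show ?thesis
    unfolding L2_def by (simp only: of_int_combination_in_lat)
qed

lemma Im_L1: "u \<in> L1 \<Longrightarrow> v \<in> L1 \<Longrightarrow> Im (cnj u * v) / area1 \<in> \<int>"
  using Im_cnj_mult_lat[of u e1 e2 v] area1_pos unfolding L1_def area1_def by (metis Ints_of_int less_irrefl nonzero_mult_div_cancel_right)

lemma Im_L2: "u \<in> L2 \<Longrightarrow> v \<in> L2 \<Longrightarrow> Im (cnj u * v) / area2 \<in> \<int>"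
  using Im_cnj_mult_lat[of u "\<mu> * e1" "\<mu> * e2 / of_nat d" v] area2_pos unfolding L2_def area2_def
  by (metis Ints_of_int less_irrefl nonzero_mult_div_cancel_right)

lemma riemann_form_NS: "riemann_form (L1 \<times> L2) (NS a b k)"
proof -
  have "NS a b k (u1, u2) (v1, v2) \<in> \<int>" if "u1 \<in> L1" "u2 \<in> L2" "v1 \<in> L1" "v2 \<in> L2" for u1 u2 v1 v2
  proof -
    have "NS a b k (u1, u2) (v1, v2) = of_int a * (Im (cnj v1 * u1) / area1) + of_int b * (Im (cnj v2 * u2) / area2)
      + of_int k * (Im (cnj v2 * (\<mu> * u1)) / area2) - of_int k * (Im (cnj u2 * (\<mu> * v1)) / area2)"
      unfolding NS_def hform_def by (simp add: algebra_simps add_divide_distrib diff_divide_distrib)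
    also have "\<dots> \<in> \<int>"
      using that by (intro Ints_add Ints_diff Ints_mult Ints_of_int Im_L1 Im_L2 mu_maps)
    finally show ?thesis .
  qed
  then show ?thesis
    unfolding riemann_form_def
    by (auto simp: NS_def bilinear_hform hform_cJ intro: hform_alternating)
qed

text \<open>The diagonal entries come from the values on generators. For the off-diagonal entry,
  unimodularity of the area pairing on \<open>L2\<close> turns integrality into the statement that
  \<open>area2 * r\<close> maps \<open>L1\<close> into \<open>L2\<close>, and \<open>hom\<close>
  makes it a multiple of \<open>\<mu>\<close>.\<close>

lemma riemann_form_imp_NS:
  assumes "riemann_form (L1 \<times> L2) E"
  obtains a b k where "E = NS a b k"
proof -
  obtain p q r where E: "E = hform p q r"
    using assms hermitian_imp_hform[of E] unfolding riemann_form_def by blast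
  have int: "hform p q r u v \<in> \<int>" if "u \<in> L1 \<times> L2" "v \<in> L1 \<times> L2" for u v
    using assms that unfolding E riemann_form_def by blast
  have zero: "0 \<in> L1" "0 \<in> L2"
    using of_int_combination_in_lat[of 0 _ 0] unfolding L1_def L2_def by simp_all
  have gen: "e1 \<in> L1" "e2 \<in> L1" "\<mu> * e1 \<in> L2" "\<mu> * e2 / of_nat d \<in> L2"
    unfolding L1_def L2_def by (simp_all only: lat_generators)
  have "hform p q r (e2, 0) (e1, 0) = p * area1"
    by (simp add: hform_def area1_def algebra_simps)
  then obtain a where a: "p * area1 = of_int a"
    using int[of "(e2, 0)" "(e1, 0)"] zero gen by (auto elim!: Ints_cases)
  have "hform p q r (0, \<mu> * e2 / of_nat d) (0, \<mu> * e1) = q * area2"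
    unfolding hform_def area2_def by (simp add: algebra_simps)
  then obtain b where b: "q * area2 = of_int b"
    using int[of "(0, \<mu> * e2 / of_nat d)" "(0, \<mu> * e1)"] zero gen by (auto elim!: Ints_cases)
  have "of_real area2 * r * u \<in> L2" if "u \<in> L1" for u
    unfolding L2_def
  proof (rule lat_dual; (fold area2_def)?)
    show "area2 \<noteq> 0"
      using area2_pos by simp
    have "Im (cnj (of_real area2 * r * u) * (\<mu> * e2 / of_nat d)) / area2 = - hform p q r (u, 0) (0, \<mu> * e2 / of_nat d)"
    proof -
      have "cnj (of_real area2 * r * u) * (\<mu> * e2 / of_nat d) = of_real area2 * (cnj (r * u) * (\<mu> * e2 / of_nat d))"
        by simp
      then have "Im (cnj (of_real area2 * r * u) * (\<mu> * e2 / of_nat d)) / area2 = Im (cnj (r * u) * (\<mu> * e2 / of_nat d))"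
        using area2_pos by (simp only: Im_of_real_mult) simp
      also have "\<dots> = - hform p q r (u, 0) (0, \<mu> * e2 / of_nat d)"
        unfolding hform_mixed by (rule Im_cnj_mult_swap)
      finally show ?thesis .
    qed
    then show "Im (cnj (of_real area2 * r * u) * (\<mu> * e2 / of_nat d)) / area2 \<in> \<int>"
      using int[of "(u, 0)" "(0, \<mu> * e2 / of_nat d)"] zero gen that by simp
    have "Im (cnj (\<mu> * e1) * (of_real area2 * r * u)) / area2 = hform p q r (u, 0) (0, \<mu> * e1)"
    proof -
      have "cnj (\<mu> * e1) * (of_real area2 * r * u) = of_real area2 * (cnj (\<mu> * e1) * (r * u))"
        by simp
      then have "Im (cnj (\<mu> * e1) * (of_real area2 * r * u)) / area2 = Im (cnj (\<mu> * e1) * (r * u))"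
        using area2_pos by (simp only: Im_of_real_mult) simp
      also have "\<dots> = hform p q r (u, 0) (0, \<mu> * e1)"
        unfolding hform_mixed ..
      finally show ?thesis .
    qed
    then show "Im (cnj (\<mu> * e1) * (of_real area2 * r * u)) / area2 \<in> \<int>"
      using int[of "(u, 0)" "(0, \<mu> * e1)"] zero gen that by simp
  qed
  then have "(\<lambda>z. (of_real area2 * r) * z) ` lat e1 e2 \<subseteq> lat (\<mu> * e1) (\<mu> * e2 / of_nat d)"
    unfolding L1_def L2_def by blast
  then obtain k where k: "of_real area2 * r = of_int k * \<mu>"
    using hom by blast
  have "p = of_int a / area1" "q = of_int b / area2" "r = of_int k * \<mu> / of_real area2"
    using a b k area1_pos area2_pos by (simp_all add: field_simps)
  then show ?thesis
    using that E unfolding NS_def by blast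
qed

lemma NS_add: "NS (a + a') (b + b') (k + k') u v = NS a b k u v + NS a' b' k' u v"
  unfolding NS_def hform_add[symmetric] by (simp add: add_divide_distrib algebra_simps)

lemma NS_inject:
  assumes "NS a b k = NS a' b' k'"
  shows "a = a'" "b = b'" "k = k'"
  using hform_inject[OF assms[unfolded NS_def]] area1_pos area2_pos \<mu> by auto

text \<open>The coefficient \<open>d\<close> of the intersection form is
  \<open>(cmod \<mu>)\<^sup>2 * area1 / area2\<close>, by \<open>area2_eq\<close>.\<close>

lemma pfaffian_NS:
  "area1 * area2 * (of_int a / area1 * (of_int b / area2) - (cmod (of_int k * \<mu> / of_real area2))\<^sup>2)
    = of_int (a * b - int d * k\<^sup>2)"
proof -
  have "area1 * area2 * (cmod (of_int k * \<mu> / of_real area2))\<^sup>2 = area1 * (of_int k)\<^sup>2 * (cmod \<mu>)\<^sup>2 / area2"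
    using area2_pos by (simp add: norm_mult norm_divide power_mult_distrib power_divide power2_eq_square)
  also have "\<dots> = of_int (int d * k\<^sup>2)"
    using area1_pos \<mu> d unfolding area2_eq by (simp add: field_simps)
  finally show ?thesis
    using area1_pos area2_pos by (simp add: algebra_simps)
qed

lemma principal_pol_NS:
  "principal_pol (L1 \<times> L2) (area1 * area2) (NS a b k) \<longleftrightarrow> a > 0 \<and> a * b = 1 + int d * k\<^sup>2"
proof -
  let ?pf = "of_int a / area1 * (of_int b / area2) - (cmod (of_int k * \<mu> / of_real area2))\<^sup>2"
  have "int_num (area1 * area2) (NS a b k) (NS a b k) = 2 * (area1 * area2 * ?pf)"
    unfolding NS_def int_num_hform_self by (simp only: mult.assoc)
  also have "\<dots> = 2 * of_int (a * b - int d * k\<^sup>2)"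
    by (simp only: pfaffian_NS)
  finally have num: "int_num (area1 * area2) (NS a b k) (NS a b k) = 2 * of_int (a * b - int d * k\<^sup>2)" .
  have "2 * real_of_int m = 2 \<longleftrightarrow> m = 1" for m
    by auto
  then have *: "int_num (area1 * area2) (NS a b k) (NS a b k) = 2 \<longleftrightarrow> a * b = 1 + int d * k\<^sup>2"
    unfolding num by (simp only: diff_eq_eq)
  have "ample (NS a b k) \<longleftrightarrow> a > 0" if "a * b = 1 + int d * k\<^sup>2"
  proof -
    have "area1 * area2 * ?pf = 1"
      unfolding pfaffian_NS using that by simp
    then have "?pf > 0"
      using area1_pos area2_pos by (metis mult_pos_pos zero_less_mult_pos zero_less_one)
    then show ?thesis
      unfolding NS_def using ample_hform area1_pos by (simp add: zero_less_divide_iff)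
  qed
  then show ?thesis
    unfolding principal_pol_def using * riemann_form_NS by blast
qed

lemma elliptic_curve_class_imp_isotropic:
  assumes "elliptic_curve_class (L1 \<times> L2) (area1 * area2) E"
  obtains x y z where "E = NS x y z" "x * y = int d * z\<^sup>2"
proof -
  obtain a b \<zeta> where ab: "a \<in> L1 \<times> L2" "b \<in> L1 \<times> L2" "b = csmul \<zeta> a"
    and E: "E = (\<lambda>x y. - det4 (\<lambda>i. [a, b, x, y] ! i) / (area1 * area2))"
    using assms unfolding elliptic_curve_class_def Let_def by (elim exE conjE IntE) (rule that)
  obtain a1 a2 where a: "a = (a1, a2)"
    by (cases a)
  define p q r where "p = Im \<zeta> * (cmod a2)\<^sup>2 / (area1 * area2)" and "q = Im \<zeta> * (cmod a1)\<^sup>2 / (area1 * area2)"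
    and "r = - of_real (Im \<zeta> / (area1 * area2)) * a2 * cnj a1"
  have E': "E = hform p q r"
    unfolding E ab(3) det4_line_hform by (simp add: a p_def q_def r_def)
  have mem: "a1 \<in> L1" "a2 \<in> L2" "\<zeta> * a1 \<in> L1" "\<zeta> * a2 \<in> L2"
    using ab a by (auto simp: csmul_def)
  have "Im (cnj a2 * (\<zeta> * a2)) = Im \<zeta> * (cmod a2)\<^sup>2" "Im (cnj a1 * (\<zeta> * a1)) = Im \<zeta> * (cmod a1)\<^sup>2"
    unfolding cmod_power2 by (simp_all add: algebra_simps power2_eq_square)
  \<comment> \<open>Areas spanned by the projections of \<open>a\<close> and \<open>b\<close>,
    relative to \<open>L2\<close> and \<open>L1\<close>; geometrically, the degrees of the two
    projections of the curve.\<close>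
  then obtain x y where x: "Im \<zeta> * (cmod a2)\<^sup>2 / area2 = of_int x" and y: "Im \<zeta> * (cmod a1)\<^sup>2 / area1 = of_int y"
    using Im_L1[OF mem(1,3)] Im_L2[OF mem(2,4)] by (auto elim!: Ints_cases)
  have p: "p = of_int x / area1" and q: "q = of_int y / area2"
    using area1_pos area2_pos x y unfolding p_def q_def by (simp_all add: field_simps)
  have "of_real area2 * r * u \<in> L2" if u: "u \<in> L1" for u
  proof -
    obtain m n where m: "Im (cnj a1 * u) / area1 = of_int m" and n: "Im (cnj u * (\<zeta> * a1)) / area1 = of_int n"
      using Im_L1[OF mem(1) u] Im_L1[OF u mem(3)] by (auto elim!: Ints_cases)
    \<comment> \<open>Cramer's rule for \<open>cnj a1 * u\<close> in the real basis
      \<open>1\<close>, \<open>\<zeta>\<close>. Multiplied by \<open>a2\<close>, it exhibits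
      \<open>area2 * r * u\<close> as an integral combination of \<open>a2\<close> and
      \<open>\<zeta> * a2\<close>.\<close>
    have "of_real (Im \<zeta>) * cnj a1 * u = of_real (Im (cnj a1 * u)) * \<zeta> + of_real (Im (cnj u * (\<zeta> * a1)))"
      by (simp add: complex_eq_iff algebra_simps)
    also have "\<dots> = of_real area1 * (of_int m * \<zeta> + of_int n)"
    proof -
      have "Im (cnj a1 * u) = area1 * of_int m" "Im (cnj u * (\<zeta> * a1)) = area1 * of_int n"
        using m n area1_pos by (simp_all add: field_simps)
      then show ?thesis
        by (simp only: of_real_mult of_real_of_int_eq distrib_left mult.assoc)
    qed
    finally have key: "of_real (Im \<zeta>) * cnj a1 * u = of_real area1 * (of_int m * \<zeta> + of_int n)" .
    have "of_real area2 * r * u = - (a2 / of_real area1) * (of_real (Im \<zeta>) * cnj a1 * u)"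
      using area1_pos area2_pos by (simp add: r_def field_simps)
    also have "\<dots> = of_int (- m) * (\<zeta> * a2) + of_int (- n) * a2"
      unfolding key using area1_pos by (simp add: field_simps)
    also have "\<dots> \<in> L2"
      using mem(2,4) unfolding L2_def by (intro lat_closed)
    finally show ?thesis .
  qed
  then have "(\<lambda>z. (of_real area2 * r) * z) ` lat e1 e2 \<subseteq> lat (\<mu> * e1) (\<mu> * e2 / of_nat d)"
    unfolding L1_def L2_def by blast
  then obtain z where "of_real area2 * r = of_int z * \<mu>"
    using hom by blast
  then have r: "r = of_int z * \<mu> / of_real area2"
    using area2_pos by (simp add: field_simps)
  have "cmod r = \<bar>Im \<zeta> / (area1 * area2)\<bar> * cmod a2 * cmod a1"
    unfolding r_def by (simp only: norm_mult norm_minus_cancel norm_of_real complex_mod_cnj)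
  then have "p * q - (cmod r)\<^sup>2 = 0"
    by (simp only: p_def q_def power_mult_distrib power2_abs) (simp add: power_divide power2_eq_square)
  then have "real_of_int (x * y - int d * z\<^sup>2) = 0"
    using pfaffian_NS[of x y z] unfolding p q r by simp
  then have "x * y = int d * z\<^sup>2"
    by linarith
  moreover have "E = NS x y z"
    unfolding E' NS_def p q r ..
  ultimately show ?thesis
    using that by blast
qed

text \<open>The curve is the image of the line through \<open>w\<close>. A multiple
  \<open>t w\<close> is a lattice point exactly when \<open>t\<close> lies in the lattice of
  \<open>e1\<close> and \<open>e2 / C\<close>: coprimality and Bezout recover \<open>t\<close> from
  \<open>A * \<alpha> * t\<close> and \<open>C * \<beta> * t\<close>.\<close>

lemma elliptic_curve_class_NS:
  assumes "A > 0" "C > 0" "A * C = int d" "coprime (A * \<alpha>) (C * \<beta>)"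
  shows "elliptic_curve_class (L1 \<times> L2) (area1 * area2) (NS (A * \<alpha>\<^sup>2) (C * \<beta>\<^sup>2) (\<alpha> * \<beta>))"
proof -
  \<comment> \<open>The slope is dictated by the off-diagonal entry, a positive multiple of
    \<open>- snd w * cnj (fst w)\<close> by \<open>det4_line_hform\<close>; the sign in
    \<open>w\<close> cancels the minus there.\<close>
  define w :: cc where "w = (of_int (C * \<beta>), - of_int \<alpha> * \<mu>)"
  define \<zeta> where "\<zeta> = e2 / (of_int C * e1)"
  define a b where "a = csmul e1 w" and "b = csmul (e2 / of_int C) w"
  define W where "W = range (\<lambda>t. csmul t w)"
  have e1: "e1 \<noteq> 0"
    using orientation by auto
  have d_eq: "complex_of_nat d = of_int A * of_int C" "real d = of_int A * of_int C"
    using assms(3) by (metis of_int_mult of_int_of_nat_eq)+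
  have nz: "of_int A \<noteq> (0::complex)" "of_int C \<noteq> (0::complex)"
    using assms(1,2) by auto
  have w: "w \<noteq> 0"
    using assms \<mu> by (auto simp: w_def zero_prod_def)
  have b: "b = csmul \<zeta> a"
    using e1 nz by (simp add: a_def b_def \<zeta>_def csmul_def)
  have comb: "of_int m *\<^sub>R a + of_int n *\<^sub>R b = csmul (of_int m * e1 + of_int n * (e2 / of_int C)) w" for m n
    by (simp add: a_def b_def csmul_def prod_eq_iff scaleR_conv_of_real algebra_simps)
  have sub: "csmul (of_int m * e1 + of_int n * (e2 / of_int C)) w \<in> W \<inter> L1 \<times> L2" for m n
  proof -
    have "fst (csmul (of_int m * e1 + of_int n * (e2 / of_int C)) w) = of_int (C * \<beta> * m) * e1 + of_int (\<beta> * n) * e2"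
      using nz by (simp add: csmul_def w_def field_simps)
    then have "fst (csmul (of_int m * e1 + of_int n * (e2 / of_int C)) w) \<in> L1"
      unfolding L1_def by (simp only: of_int_combination_in_lat)
    moreover have "snd (csmul (of_int m * e1 + of_int n * (e2 / of_int C)) w)
        = of_int (- \<alpha> * m) * (\<mu> * e1) + of_int (- \<alpha> * n * A) * (\<mu> * e2 / of_nat d)"
      using nz by (simp add: csmul_def w_def d_eq field_simps)
    then have "snd (csmul (of_int m * e1 + of_int n * (e2 / of_int C)) w) \<in> L2"
      unfolding L2_def by (simp only: of_int_combination_in_lat)
    ultimately show ?thesis
      unfolding W_def by (auto simp: mem_Times_iff)
  qed
  have sup: "\<exists>m n. v = of_int m *\<^sub>R a + of_int n *\<^sub>R b" if "v \<in> W \<inter> L1 \<times> L2" for v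
  proof -
    obtain t where t: "v = csmul t w" "fst v \<in> L1" "snd v \<in> L2"
      using \<open>v \<in> W \<inter> L1 \<times> L2\<close> unfolding W_def by (metis IntD1 IntD2 mem_Times_iff rangeE)
    obtain m n where mn: "of_int C * of_int \<beta> * t = of_int m * e1 + of_int n * e2"
      using t(2) unfolding t(1) L1_def lat_def by (auto simp: csmul_def w_def algebra_simps)
    obtain m' n' where eq: "- (\<mu> * (of_int \<alpha> * t)) = of_int m' * (\<mu> * e1) + of_int n' * (\<mu> * e2 / of_nat d)"
      using t(3) unfolding t(1) L2_def lat_def by (auto simp: csmul_def w_def algebra_simps)
    have "\<mu> * (of_int \<alpha> * t) = - (of_int m' * (\<mu> * e1) + of_int n' * (\<mu> * e2 / of_nat d))"
      by (simp only: eq[symmetric] minus_minus)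
    also have "\<dots> = \<mu> * (- (of_int m' * e1 + of_int n' * (e2 / of_nat d)))"
      by (simp add: algebra_simps)
    finally have mn': "of_int \<alpha> * t = - (of_int m' * e1 + of_int n' * (e2 / of_nat d))"
      using \<mu> by (simp only: mult_cancel_left simp_thms)
    obtain P Q where PQ: "P * (A * \<alpha>) + Q * (C * \<beta>) = 1"
      using assms(4) bezout_int[of "A * \<alpha>" "C * \<beta>"] by auto
    have "t = of_int (P * (A * \<alpha>) + Q * (C * \<beta>)) * t"
      unfolding PQ by simp
    also have "\<dots> = of_int P * of_int A * (of_int \<alpha> * t) + of_int Q * (of_int C * of_int \<beta> * t)"
      by (simp add: algebra_simps)
    also have "\<dots> = of_int (Q * m - P * A * m') * e1 + of_int (Q * n * C - P * n') * (e2 / of_int C)"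
      unfolding mn mn' d_eq using nz by (simp add: field_simps)
    finally show ?thesis
      unfolding t(1) comb by blast
  qed
  have W: "W \<inter> L1 \<times> L2 = {of_int m *\<^sub>R a + of_int n *\<^sub>R b | m n. True}"
    using sub sup unfolding comb by blast
  have ab: "a \<in> W \<inter> L1 \<times> L2" "b \<in> W \<inter> L1 \<times> L2"
    using sub[of 1 0] sub[of 0 1] by (simp_all add: a_def b_def)
  have "a \<noteq> 0"
    using w e1 by (auto simp: a_def csmul_def zero_prod_def prod_eq_iff)
  have Im\<zeta>: "Im \<zeta> = area1 / (of_int C * (cmod e1)\<^sup>2)"
  proof -
    have "\<zeta> = of_real (1 / (of_int C * (cmod e1)\<^sup>2)) * (cnj e1 * e2)"
      using e1 nz by (simp add: \<zeta>_def complex_norm_square del: of_real_power)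
    then show ?thesis
      unfolding area1_def by (simp only: Im_of_real_mult) simp
  qed
  then have "Im \<zeta> > 0"
    using area1_pos assms(2) e1 by simp
  have eq: "NS (A * \<alpha>\<^sup>2) (C * \<beta>\<^sup>2) (\<alpha> * \<beta>) = (\<lambda>x y. - det4 (\<lambda>i. [a, b, x, y] ! i) / (area1 * area2))"
  proof -
    have pos: "area1 > 0" "area2 > 0" "real_of_int C > 0" "cmod e1 > 0" "cmod \<mu> > 0"
      using area1_pos area2_pos assms(2) e1 \<mu> by auto
    have area: "area2 * (of_int A * of_int C) = (cmod \<mu>)\<^sup>2 * area1"
      using area2_eq d d_eq(2) assms(1,2) by (simp add: field_simps)
    have "Im \<zeta> * (cmod (snd a))\<^sup>2 / (area1 * area2) = of_int (A * \<alpha>\<^sup>2) / area1"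
    proof -
      have "Im \<zeta> * (cmod (snd a))\<^sup>2 / (area1 * area2) = (cmod \<mu>)\<^sup>2 * area1 * (of_int \<alpha>)\<^sup>2 / (of_int C * area1 * area2)"
        using pos by (simp add: Im\<zeta> a_def w_def csmul_def norm_mult power_mult_distrib field_simps)
      also have "\<dots> = of_int (A * \<alpha>\<^sup>2) / area1"
        unfolding area[symmetric] using pos by (simp add: field_simps)
      finally show ?thesis .
    qed
    moreover have "Im \<zeta> * (cmod (fst a))\<^sup>2 / (area1 * area2) = of_int (C * \<beta>\<^sup>2) / area2"
      using pos by (simp add: Im\<zeta> a_def w_def csmul_def norm_mult power_mult_distrib field_simps power2_eq_square)
    moreover have "- of_real (Im \<zeta> / (area1 * area2)) * snd a * cnj (fst a) = of_int (\<alpha> * \<beta>) * \<mu> / of_real area2"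
    proof -
      have "snd a * cnj (fst a) = - (of_int (\<alpha> * \<beta> * C) * \<mu> * of_real ((cmod e1)\<^sup>2))"
        by (simp add: a_def w_def csmul_def complex_norm_square algebra_simps del: of_real_power)
      then have "- of_real (Im \<zeta> / (area1 * area2)) * snd a * cnj (fst a)
          = of_real (Im \<zeta> / (area1 * area2) * (cmod e1)\<^sup>2 * of_int C) * (of_int (\<alpha> * \<beta>) * \<mu>)"
        by (simp add: mult.assoc)
      also have "Im \<zeta> / (area1 * area2) * (cmod e1)\<^sup>2 * of_int C = 1 / area2"
        using pos by (simp add: Im\<zeta> field_simps)
      finally show ?thesis
        by simp
    qed
    ultimately show ?thesis
      unfolding NS_def b det4_line_hform by simp
  qed
  show ?thesis
    unfolding elliptic_curve_class_def Let_def
    using w \<open>a \<noteq> 0\<close> ab[unfolded W_def] W[unfolded W_def] b \<open>Im \<zeta> > 0\<close> eq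
    by (intro exI[of _ w] exI[of _ a] exI[of _ b] exI[of _ \<zeta>] conjI)
qed

end

section \<open>Degrees of isogenies\<close>

lemma lat_coordinates_unique:
  assumes "Im (cnj w1 * w2) \<noteq> 0" "of_int a * w1 + of_int b * w2 = of_int a' * w1 + of_int b' * w2"
  shows "a = a'" "b = b'"
proof -
  have "Im (cnj w1 * (of_int m * w1 + of_int n * w2)) = of_int n * Im (cnj w1 * w2)"
    "Im (cnj (of_int m * w1 + of_int n * w2) * w2) = of_int m * Im (cnj w1 * w2)" for m n
    by (simp_all add: algebra_simps)
  then have "of_int b * Im (cnj w1 * w2) = of_int b' * Im (cnj w1 * w2)"
    "of_int a * Im (cnj w1 * w2) = of_int a' * Im (cnj w1 * w2)"
    using assms(2) by metis+
  then show "a = a'" "b = b'"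
    using assms(1) by auto
qed

lemma lat_coset_eq_iff:
  "(\<lambda>z. x + z) ` lat w1 w2 = (\<lambda>z. y + z) ` lat w1 w2 \<longleftrightarrow> x - y \<in> lat w1 w2"
proof
  assume eq: "(\<lambda>z. x + z) ` lat w1 w2 = (\<lambda>z. y + z) ` lat w1 w2"
  have "x + 0 \<in> (\<lambda>z. x + z) ` lat w1 w2"
    using of_int_combination_in_lat[of 0 w1 0 w2] by (intro imageI) simp
  then obtain z where "z \<in> lat w1 w2" "x + 0 = y + z"
    unfolding eq by blast
  then show "x - y \<in> lat w1 w2"
    by simp
next
  assume xy: "x - y \<in> lat w1 w2"
  have "(\<lambda>z. u + z) ` lat w1 w2 \<subseteq> (\<lambda>z. v + z) ` lat w1 w2" if "u - v \<in> lat w1 w2" for u v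
  proof
    fix t assume "t \<in> (\<lambda>z. u + z) ` lat w1 w2"
    then obtain z where "z \<in> lat w1 w2" "t = u + z"
      by blast
    then have "t = v + (of_int 1 * (u - v) + of_int 1 * z)"
      by simp
    then show "t \<in> (\<lambda>z. v + z) ` lat w1 w2"
      using lat_closed[OF that \<open>z \<in> lat w1 w2\<close>] by blast
  qed
  moreover have "y - x \<in> lat w1 w2"
    using lat_closed[OF xy xy, of "-1" 0] by simp
  ultimately show "(\<lambda>z. x + z) ` lat w1 w2 = (\<lambda>z. y + z) ` lat w1 w2"
    using xy by blast
qed

lemma card_lat_cosets:
  fixes M N :: nat
  assumes "Im (cnj w1 * w2) \<noteq> 0" "M > 0" "N > 0"
  shows "card ((\<lambda>x. (\<lambda>z. x + z) ` lat (of_nat M * w1) (of_nat N * w2)) ` lat w1 w2) = M * N"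
proof -
  define S where "S = lat (of_nat M * w1) (of_nat N * w2)"
  define f where "f = (\<lambda>(i::int, j::int). (\<lambda>z. (of_int i * w1 + of_int j * w2) + z) ` S)"
  have f_eq: "f (i, j) = f (i', j') \<longleftrightarrow> int M dvd i - i' \<and> int N dvd j - j'" for i j i' j'
  proof -
    have "f (i, j) = f (i', j') \<longleftrightarrow> of_int (i - i') * w1 + of_int (j - j') * w2 \<in> S"
      by (simp only: f_def prod.case S_def lat_coset_eq_iff) (simp add: algebra_simps)
    also have "\<dots> \<longleftrightarrow> (\<exists>m n. of_int (i - i') * w1 + of_int (j - j') * w2 = of_int (int M * m) * w1 + of_int (int N * n) * w2)"
      unfolding S_def lat_def by (auto simp: mult_ac)
    also have "\<dots> \<longleftrightarrow> (\<exists>m n. i - i' = int M * m \<and> j - j' = int N * n)"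
      using lat_coordinates_unique[OF assms(1)] by metis
    finally show ?thesis
      unfolding dvd_def by blast
  qed
  have "(\<lambda>x. (\<lambda>z. x + z) ` S) ` lat w1 w2 = f ` ({0..<int M} \<times> {0..<int N})"
  proof (intro equalityI subsetI)
    fix X assume "X \<in> (\<lambda>x. (\<lambda>z. x + z) ` S) ` lat w1 w2"
    then obtain i j where "X = f (i, j)"
      unfolding lat_def f_def by auto
    also have "\<dots> = f (i mod int M, j mod int N)"
      unfolding f_eq by (simp add: mod_eq_dvd_iff[symmetric])
    finally show "X \<in> f ` ({0..<int M} \<times> {0..<int N})"
      using assms(2,3) by auto
  next
    fix X assume "X \<in> f ` ({0..<int M} \<times> {0..<int N})"
    then show "X \<in> (\<lambda>x. (\<lambda>z. x + z) ` S) ` lat w1 w2"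
      unfolding f_def using of_int_combination_in_lat by force
  qed
  moreover have "inj_on f ({0..<int M} \<times> {0..<int N})"
  proof (rule inj_onI, clarify)
    fix i j i' j'
    assume "f (i, j) = f (i', j')" "i \<in> {0..<int M}" "j \<in> {0..<int N}" "i' \<in> {0..<int M}" "j' \<in> {0..<int N}"
    then show "i = i' \<and> j = j'"
      unfolding f_eq mod_eq_dvd_iff[symmetric] by simp
  qed
  ultimately show ?thesis
    unfolding S_def[symmetric] by (simp add: card_image)
qed

context lattice_pair
begin

text \<open>In the adapted bases multiplication by \<open>k * \<mu>\<close> is diagonal with entries
  \<open>k\<close> and \<open>k * d\<close>; the sign of \<open>k\<close> does not affect the image
  lattice.\<close>

lemma isog_deg_multiple:
  assumes "k \<noteq> 0"
  shows "isog_deg L1 L2 (of_int k * \<mu>) = (nat \<bar>k\<bar>)\<^sup>2 * d"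
proof -
  define K where "K = nat \<bar>k\<bar>"
  have kK: "k = int K \<or> k = - int K"
    unfolding K_def by auto
  have "(\<lambda>z. of_int k * \<mu> * z) ` L1 = lat (of_nat K * (\<mu> * e1)) (of_nat (K * d) * (\<mu> * e2 / of_nat d))"
  proof -
    have "(\<lambda>z. of_int k * \<mu> * z) ` L1 = lat (of_int k * (\<mu> * e1)) (of_int k * (\<mu> * e2))"
      unfolding L1_def image_mult_lat by (simp only: mult.assoc)
    also have "\<dots> = lat (of_nat K * (\<mu> * e1)) (of_nat K * (\<mu> * e2))"
      using kK
    proof
      assume k: "k = - int K"
      have "lat (- x) (- y) = lat x y" for x y
        using of_int_combination_in_lat[of "-1" x 0 y] of_int_combination_in_lat[of 0 x "-1" y]
          of_int_combination_in_lat[of "-1" "- x" 0 "- y"] of_int_combination_in_lat[of 0 "- x" "-1" "- y"]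
        by (intro lat_eqI) simp_all
      then show ?thesis
        unfolding k by simp
    qed simp
    also have "of_nat K * (\<mu> * e2) = of_nat (K * d) * (\<mu> * e2 / of_nat d)"
      using d by simp
    finally show ?thesis .
  qed
  moreover have "card ((\<lambda>x. (\<lambda>z. x + z) ` lat (of_nat K * (\<mu> * e1)) (of_nat (K * d) * (\<mu> * e2 / of_nat d))) ` L2)
      = K * (K * d)"
    unfolding L2_def using area2_pos assms d by (intro card_lat_cosets) (auto simp: area2_def K_def)
  ultimately show ?thesis
    unfolding isog_deg_def K_def[symmetric] by (simp add: power2_eq_square)
qed

lemma min_isog_deg_eq: "min_isog_deg L1 L2 = d"
  unfolding min_isog_deg_def
proof (rule Least_equality)
  have "is_isogeny L1 L2 \<mu>"
    unfolding is_isogeny_def using \<mu> mu_maps by auto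
  moreover have "isog_deg L1 L2 \<mu> = d"
    using isog_deg_multiple[of 1] by simp
  ultimately show "\<exists>\<alpha>. is_isogeny L1 L2 \<alpha> \<and> isog_deg L1 L2 \<alpha> = d"
    by blast
next
  fix n
  assume "\<exists>\<alpha>. is_isogeny L1 L2 \<alpha> \<and> isog_deg L1 L2 \<alpha> = n"
  then obtain \<alpha> where \<alpha>: "\<alpha> \<noteq> 0" "(\<lambda>z. \<alpha> * z) ` L1 \<subseteq> L2" and n: "isog_deg L1 L2 \<alpha> = n"
    unfolding is_isogeny_def by blast
  obtain k where k: "\<alpha> = of_int k * \<mu>"
    using hom[OF \<alpha>(2)[unfolded L1_def L2_def]] by blast
  then have "k \<noteq> 0"
    using \<alpha>(1) by auto
  then have "n = (nat \<bar>k\<bar>)\<^sup>2 * d"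
    using isog_deg_multiple n k by simp
  moreover have "1 \<le> (nat \<bar>k\<bar>)\<^sup>2"
    using \<open>k \<noteq> 0\<close> by simp
  ultimately show "d \<le> n"
    by simp
qed

section \<open>From integer triples back to polarizations\<close>

lemma pf_std_NS: "area1 * area2 * pf_std (NS a b k) = of_int (a * b - int d * k\<^sup>2)"
  using pfaffian_NS unfolding NS_def pf_std_hform by blast

text \<open>The sums for \<open>a\<close>, \<open>b\<close> and \<open>k\<close> are split term by
  term. The unit determinant yields the coprimality required by
  \<open>elliptic_curve_class_NS\<close>; the curves meet in 1 because both are isotropic and their
  sum has self-intersection 2.\<close>

lemma reducible_pp_NS:
  assumes "A > 0" "C > 0" "A * C = int d" "A * \<alpha> * \<delta> - C * \<beta> * \<gamma> = 1"
    and a: "a = A * \<alpha>\<^sup>2 + C * \<gamma>\<^sup>2" and b: "b = C * \<beta>\<^sup>2 + A * \<delta>\<^sup>2" and k: "k = \<alpha> * \<beta> + \<gamma> * \<delta>"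
    and pp: "a > 0" "a * b = 1 + int d * k\<^sup>2"
  shows "reducible_pp (L1 \<times> L2) (area1 * area2) (NS a b k)"
proof -
  let ?F = "NS (A * \<alpha>\<^sup>2) (C * \<beta>\<^sup>2) (\<alpha> * \<beta>)" and ?G = "NS (C * \<gamma>\<^sup>2) (A * \<delta>\<^sup>2) (\<gamma> * \<delta>)"
  have "coprime (A * \<alpha>) (C * \<beta>)"
  proof (rule coprimeI)
    fix c assume "c dvd A * \<alpha>" "c dvd C * \<beta>"
    then have "c dvd A * \<alpha> * \<delta> - C * \<beta> * \<gamma>"
      by (meson dvd_diff dvd_mult2)
    then show "is_unit c"
      using assms(4) by simp
  qed
  moreover have "coprime (C * \<gamma>) (A * \<delta>)"
  proof (rule coprimeI)
    fix c assume "c dvd C * \<gamma>" "c dvd A * \<delta>"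
    then have "c dvd (A * \<delta>) * \<alpha> - (C * \<gamma>) * \<beta>"
      by (meson dvd_diff dvd_mult2)
    then show "is_unit c"
      using assms(4) by (simp add: algebra_simps)
  qed
  ultimately have "elliptic_curve_class (L1 \<times> L2) (area1 * area2) ?F"
    "elliptic_curve_class (L1 \<times> L2) (area1 * area2) ?G"
    using elliptic_curve_class_NS[OF assms(1-3)] elliptic_curve_class_NS[OF assms(2,1)] assms(3)
    by (simp_all only: mult.commute[of C A])
  moreover have sum: "NS a b k = (\<lambda>x y. ?F x y + ?G x y)"
    unfolding a b k by (intro ext) (rule NS_add)
  moreover have "int_num (area1 * area2) ?F ?G = 1"
  proof -
    have "A * \<alpha>\<^sup>2 * (C * \<beta>\<^sup>2) - int d * (\<alpha> * \<beta>)\<^sup>2 = 0" "C * \<gamma>\<^sup>2 * (A * \<delta>\<^sup>2) - int d * (\<gamma> * \<delta>)\<^sup>2 = 0"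
      unfolding assms(3)[symmetric] by (simp_all add: algebra_simps power2_eq_square)
    then show ?thesis
      unfolding int_num_def sum[symmetric] pf_std_NS using pp(2) by simp
  qed
  moreover have "principal_pol (L1 \<times> L2) (area1 * area2) (NS a b k)"
    using pp by (simp add: principal_pol_NS)
  ultimately show ?thesis
    unfolding reducible_pp_def by blast
qed

lemma irreducible_pp_NS:
  assumes "irreducible_triple (int d) a b k"
  shows "irreducible_pp (L1 \<times> L2) (area1 * area2) (NS a b k)"
proof -
  have pp: "a > 0" "a * b = 1 + int d * k\<^sup>2"
    and irr: "\<And>x y z. x * y = int d * z\<^sup>2 \<Longrightarrow> x * b + y * a - 2 * int d * k * z \<noteq> 1"
    using assms unfolding irreducible_triple_def by auto
  have False if red: "reducible_pp (L1 \<times> L2) (area1 * area2) (NS a b k)"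
  proof -
    obtain F G where F: "elliptic_curve_class (L1 \<times> L2) (area1 * area2) F"
      and G: "elliptic_curve_class (L1 \<times> L2) (area1 * area2) G" and sum: "NS a b k = (\<lambda>x y. F x y + G x y)"
      using red unfolding reducible_pp_def by blast
    obtain x y z where xyz: "F = NS x y z" "x * y = int d * z\<^sup>2"
      by (rule elliptic_curve_class_imp_isotropic[OF F])
    obtain x' y' z' where xyz': "G = NS x' y' z'" "x' * y' = int d * z'\<^sup>2"
      by (rule elliptic_curve_class_imp_isotropic[OF G])
    have "NS a b k = NS (x + x') (y + y') (z + z')"
      unfolding sum xyz(1) xyz'(1) by (intro ext) (rule NS_add[symmetric])
    note abk = NS_inject[OF this]
    \<comment> \<open>The identity \<open>E.F = (E\<^sup>2 + F\<^sup>2 - G\<^sup>2) / 2\<close> for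
      \<open>E = F + G\<close>, in coordinates; only \<open>E\<^sup>2 = 2\<close>
      contributes.\<close>
    have "x * b + y * a - 2 * int d * k * z
        = (a * b - int d * k\<^sup>2) + (x * y - int d * z\<^sup>2) - (x' * y' - int d * z'\<^sup>2)"
      unfolding abk by (simp add: algebra_simps power2_eq_square)
    then show False
      using irr[OF xyz(2)] xyz xyz' pp(2) by simp
  qed
  then show ?thesis
    unfolding irreducible_pp_def using pp by (auto simp: principal_pol_NS)
qed

theorem no_irreducible_pp_iff:
  "(\<nexists>E. irreducible_pp (L1 \<times> L2) (area1 * area2) E) \<longleftrightarrow> d = 1 \<or> (idoneal d \<and> d mod 8 \<in> {2, 4, 6})"
proof
  assume "\<nexists>E. irreducible_pp (L1 \<times> L2) (area1 * area2) E"
  then show "d = 1 \<or> (idoneal d \<and> d mod 8 \<in> {2, 4, 6})"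
    using irreducible_triple_exists[OF d] irreducible_pp_NS by blast
next
  assume cond: "d = 1 \<or> (idoneal d \<and> d mod 8 \<in> {2, 4, 6})"
  show "\<nexists>E. irreducible_pp (L1 \<times> L2) (area1 * area2) E"
  proof
    assume "\<exists>E. irreducible_pp (L1 \<times> L2) (area1 * area2) E"
    then obtain E where E: "principal_pol (L1 \<times> L2) (area1 * area2) E" "\<not> reducible_pp (L1 \<times> L2) (area1 * area2) E"
      unfolding irreducible_pp_def by blast
    then have "riemann_form (L1 \<times> L2) E"
      unfolding principal_pol_def by blast
    then obtain a b k where NS: "E = NS a b k"
      by (rule riemann_form_imp_NS)
    have pp: "a > 0" "a * b = 1 + int d * k\<^sup>2"
      using E(1) unfolding NS principal_pol_NS by auto
    show False
      by (rule solution_decomposition[OF cond pp(2,1)])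
         (use E(2) reducible_pp_NS pp in \<open>unfold NS; blast\<close>)
  qed
qed

end

section \<open>Adapted lattice bases\<close>

text \<open>By Cramer's rule only primes dividing the determinant can divide the image of a
  primitive vector. For each of these some column of the matrix is nonzero modulo the prime, and
  \<open>X\<close>, \<open>Y\<close> are chosen so that just this column survives.\<close>

lemma primitive_matrix_primitive_column:
  fixes p q r s :: int
  assumes det: "p * s - q * r \<noteq> 0"
    and prim: "\<And>l::nat. prime l \<Longrightarrow> \<not> (int l dvd p \<and> int l dvd q \<and> int l dvd r \<and> int l dvd s)"
  obtains X Y where "coprime X Y" "coprime (p * X + r * Y) (q * X + s * Y)"
proof -
  define D where "D = p * s - q * r"
  define S where "S = {l::nat. prime l \<and> int l dvd D}"
  have "finite S"
  proof (rule finite_subset)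
    show "S \<subseteq> {l. l dvd nat \<bar>D\<bar>}"
      by (auto simp: S_def)
    show "finite {l. l dvd nat \<bar>D\<bar>}"
      using det unfolding D_def by (intro finite_divisors_nat) auto
  qed
  define Q where "Q = {l\<in>S. \<not> (int l dvd p \<and> int l dvd q)}"
  obtain X Y where cop: "coprime X Y" and X: "\<And>l. prime l \<Longrightarrow> int l dvd X \<longleftrightarrow> l \<in> S - Q"
    and Y: "\<And>l. prime l \<Longrightarrow> int l dvd Y \<longleftrightarrow> l \<in> Q"
  proof (rule coprime_pair_with_prime_divisors)
    show "finite (S - Q)" "finite Q"
      using \<open>finite S\<close> by (simp_all add: Q_def)
    show "(S - Q) \<inter> Q = {}" "\<forall>l\<in>S - Q. prime l" "\<forall>l\<in>Q. prime l"
      by (auto simp: Q_def S_def)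
  qed blast
  have DX: "D * X = s * (p * X + r * Y) - r * (q * X + s * Y)"
    and DY: "D * Y = p * (q * X + s * Y) - q * (p * X + r * Y)"
    by (simp_all add: D_def algebra_simps)
  have "D \<noteq> 0"
    using det by (simp add: D_def)
  have "coprime (p * X + r * Y) (q * X + s * Y)"
  proof (rule ccontr)
    assume "\<not> coprime (p * X + r * Y) (q * X + s * Y)"
    moreover have "p * X + r * Y \<noteq> 0 \<or> q * X + s * Y \<noteq> 0"
    proof (rule ccontr)
      assume "\<not> (p * X + r * Y \<noteq> 0 \<or> q * X + s * Y \<noteq> 0)"
      then have "X = 0" "Y = 0"
        using DX DY \<open>D \<noteq> 0\<close> by auto
      then show False
        using cop by simp
    qed
    ultimately obtain l where l: "prime l" "int l dvd p * X + r * Y" "int l dvd q * X + s * Y"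
      by (elim not_coprime_int_prime)
    have prime: "prime (int l)"
      using l(1) by simp
    have "int l dvd D * X" "int l dvd D * Y"
      unfolding DX DY using l by (auto intro!: dvd_diff dvd_mult)
    then have "int l dvd D"
      using prime cop by (metis coprime_common_divisor not_prime_unit prime_dvd_mult_iff)
    then have "l \<in> S"
      using l(1) by (simp add: S_def)
    show False
    proof (cases "l \<in> Q")
      case True
      then have "int l dvd Y" "\<not> int l dvd X"
        using X[OF l(1)] Y[OF l(1)] by auto
      then have "int l dvd p * X" "int l dvd q * X"
        using l(2,3) by (simp_all add: dvd_add_left_iff)
      then show False
        using True \<open>\<not> int l dvd X\<close> prime by (simp add: prime_dvd_mult_iff Q_def)
    next
      case False
      then have "int l dvd X" "\<not> int l dvd Y" "int l dvd p" "int l dvd q"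
        using X[OF l(1)] Y[OF l(1)] \<open>l \<in> S\<close> by (auto simp: Q_def)
      then have "int l dvd r * Y" "int l dvd s * Y"
        using l(2,3) by (simp_all add: dvd_add_right_iff)
      then show False
        using prim[OF l(1)] \<open>\<not> int l dvd Y\<close> \<open>int l dvd p\<close> \<open>int l dvd q\<close> prime by (simp add: prime_dvd_mult_iff)
    qed
  qed
  then show ?thesis
    using that cop by blast
qed

lemma lat_unimodular:
  fixes X Y U V :: int
  assumes "X * V - Y * U = 1"
  shows "lat (of_int X * w1 + of_int Y * w2) (of_int U * w1 + of_int V * w2) = lat w1 w2"
proof (rule lat_eqI)
  let ?u = "of_int X * w1 + of_int Y * w2" and ?v = "of_int U * w1 + of_int V * w2"
  have "of_int V * ?u + of_int (- Y) * ?v = of_int (X * V - Y * U) * w1"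
    "of_int (- U) * ?u + of_int X * ?v = of_int (X * V - Y * U) * w2"
    by (simp_all add: algebra_simps)
  then show "w1 \<in> lat ?u ?v" "w2 \<in> lat ?u ?v"
    using of_int_combination_in_lat[of V ?u "- Y" ?v] of_int_combination_in_lat[of "- U" ?u X ?v] assms
    by simp_all
qed (rule of_int_combination_in_lat)+

lemma lat_shear_sign:
  assumes "t = 1 \<or> t = -1"
  shows "lat w1 (of_int t * (w2 - of_int m * w1)) = lat w1 w2"
proof (rule lat_eqI)
  let ?v = "of_int t * (w2 - of_int m * w1)"
  show "w1 \<in> lat w1 w2" "w1 \<in> lat w1 ?v"
    by (rule lat_generators)+
  show "?v \<in> lat w1 w2"
    using of_int_combination_in_lat[of "- t * m" w1 t w2] by (simp add: algebra_simps)
  show "w2 \<in> lat w1 ?v"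
    using of_int_combination_in_lat[of m w1 t ?v] assms by auto
qed

lemma lat_area_unique:
  assumes "lat u v = lat w1 w2" "Im (cnj w1 * w2) \<noteq> 0"
  shows "\<bar>Im (cnj u * v)\<bar> = \<bar>Im (cnj w1 * w2)\<bar>"
proof -
  obtain n where n: "Im (cnj u * v) = of_int n * Im (cnj w1 * w2)"
    using Im_cnj_mult_lat[of u w1 w2 v] lat_generators[where ?w1.0 = u and ?w2.0 = v] assms(1) by auto
  obtain m where m: "Im (cnj w1 * w2) = of_int m * Im (cnj u * v)"
    using Im_cnj_mult_lat[of w1 u v w2] lat_generators[where ?w1.0 = w1 and ?w2.0 = w2] assms(1) by auto
  have "Im (cnj w1 * w2) * 1 = Im (cnj w1 * w2) * of_int (m * n)"
    using n m by (metis mult.assoc mult.commute mult.right_neutral of_int_mult)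
  then have "real_of_int (m * n) = 1"
    using assms(2) by (simp only: mult_cancel_left simp_thms)
  then have "m * n = 1"
    by linarith
  then have "\<bar>n\<bar> = 1"
    by (metis abs_mult abs_of_nonneg abs_zmult_eq_1 mult.commute zero_le_one)
  then show ?thesis
    unfolding n abs_mult by (metis mult_1 of_int_1 of_int_abs)
qed

text \<open>This multiplication is the dual isogeny, the adjoint of \<open>\<nu>\<close> for the
  normalized area pairings: pairing its value with \<open>w11\<close> and \<open>w12\<close> amounts
  to pairing \<open>v\<close> with their images under \<open>\<nu>\<close>, which is
  integral.\<close>

lemma dual_isogeny:
  assumes "Im (cnj w11 * w12) \<noteq> 0" "Im (cnj w21 * w22) \<noteq> 0"
    and "(\<lambda>z. \<nu> * z) ` lat w11 w12 \<subseteq> lat w21 w22" "v \<in> lat w21 w22"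
  shows "cnj \<nu> * of_real (Im (cnj w11 * w12) / Im (cnj w21 * w22)) * v \<in> lat w11 w12"
proof (rule lat_dual[OF assms(1)])
  define o1 o2 where "o1 = Im (cnj w11 * w12)" and "o2 = Im (cnj w21 * w22)"
  have nz: "o1 \<noteq> 0" "o2 \<noteq> 0"
    using assms unfolding o1_def o2_def by auto
  have int: "Im (cnj x * y) / o2 \<in> \<int>" if "x \<in> lat w21 w22" "y \<in> lat w21 w22" for x y
    using Im_cnj_mult_lat[OF that] nz unfolding o2_def by (metis Ints_of_int nonzero_mult_div_cancel_right)
  have mem: "\<nu> * w11 \<in> lat w21 w22" "\<nu> * w12 \<in> lat w21 w22"
    using assms(3) lat_generators by blast+
  have "cnj (cnj \<nu> * of_real (o1 / o2) * v) * w12 = of_real (o1 / o2) * (cnj v * (\<nu> * w12))"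
    by simp
  then have "Im (cnj (cnj \<nu> * of_real (o1 / o2) * v) * w12) / o1 = Im (cnj v * (\<nu> * w12)) / o2"
    using nz by (simp only: Im_of_real_mult) simp
  then show "Im (cnj (cnj \<nu> * of_real (Im (cnj w11 * w12) / Im (cnj w21 * w22)) * v) * w12) / Im (cnj w11 * w12) \<in> \<int>"
    using int[OF assms(4) mem(2)] unfolding o1_def o2_def by (simp only:)
  have "cnj w11 * (cnj \<nu> * of_real (o1 / o2) * v) = of_real (o1 / o2) * (cnj (\<nu> * w11) * v)"
    by simp
  then have "Im (cnj w11 * (cnj \<nu> * of_real (o1 / o2) * v)) / o1 = Im (cnj (\<nu> * w11) * v) / o2"
    using nz by (simp only: Im_of_real_mult) simp
  then show "Im (cnj w11 * (cnj \<nu> * of_real (Im (cnj w11 * w12) / Im (cnj w21 * w22)) * v)) / Im (cnj w11 * w12) \<in> \<int>"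
    using int[OF mem(1) assms(4)] unfolding o1_def o2_def by (simp only:)
qed

text \<open>Composing a homomorphism with the dual of another gives an endomorphism of the first
  curve, which is an integer without complex multiplication. Degrees are thus natural numbers, and
  division with remainder by a nonzero homomorphism of least degree shows that it generates.\<close>

lemma hom_cyclic:
  assumes o1: "Im (cnj w11 * w12) \<noteq> 0" and o2: "Im (cnj w21 * w22) \<noteq> 0"
    and CM: "\<not> has_CM (lat w11 w12)" and iso: "isogenous (lat w11 w12) (lat w21 w22)"
  obtains \<mu> where "\<mu> \<noteq> 0" "(\<lambda>z. \<mu> * z) ` lat w11 w12 \<subseteq> lat w21 w22"
    "\<And>\<nu>. (\<lambda>z. \<nu> * z) ` lat w11 w12 \<subseteq> lat w21 w22 \<Longrightarrow> \<exists>k. \<nu> = of_int k * \<mu>"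
proof -
  define H where "H = {\<nu>. (\<lambda>z. \<nu> * z) ` lat w11 w12 \<subseteq> lat w21 w22}"
  define \<rho> where "\<rho> = Im (cnj w11 * w12) / Im (cnj w21 * w22)"
  have \<rho>: "\<rho> \<noteq> 0"
    using o1 o2 by (simp add: \<rho>_def)
  have H_closed: "\<nu> - of_int k * \<nu>' \<in> H" if "\<nu> \<in> H" "\<nu>' \<in> H" for \<nu> \<nu>' k
  proof -
    have "(\<nu> - of_int k * \<nu>') * z \<in> lat w21 w22" if z: "z \<in> lat w11 w12" for z
    proof -
      have "\<nu> * z \<in> lat w21 w22" "\<nu>' * z \<in> lat w21 w22"
        using \<open>\<nu> \<in> H\<close> \<open>\<nu>' \<in> H\<close> z unfolding H_def by auto
      then show ?thesis
        using lat_closed[of "\<nu> * z" w21 w22 "\<nu>' * z" 1 "- k"] by (simp add: algebra_simps)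
    qed
    then show ?thesis
      unfolding H_def by auto
  qed
  have pairing: "\<exists>m. cnj \<nu> * of_real \<rho> * \<nu>' = of_int m" if \<nu>: "\<nu> \<in> H" and \<nu>': "\<nu>' \<in> H" for \<nu> \<nu>'
  proof -
    have "cnj \<nu> * of_real \<rho> * \<nu>' * z \<in> lat w11 w12" if z: "z \<in> lat w11 w12" for z
    proof -
      have "\<nu>' * z \<in> lat w21 w22"
        using \<nu>' z unfolding H_def by auto
      then show ?thesis
        using dual_isogeny[OF o1 o2, of \<nu> "\<nu>' * z"] \<nu> unfolding H_def \<rho>_def by (simp only: mult.assoc mem_Collect_eq)
    qed
    then have "cnj \<nu> * of_real \<rho> * \<nu>' \<in> \<int>"
      using CM unfolding has_CM_def by (metis image_subsetI)
    then show ?thesis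
      by (auto elim!: Ints_cases)
  qed
  \<comment> \<open>The given bases may have opposite orientations, in which case
    \<open>\<rho>\<close> is negative.\<close>
  define deg where "deg = (\<lambda>\<nu>. (cmod \<nu>)\<^sup>2 * \<bar>\<rho>\<bar>)"
  have deg_nat: "\<exists>n::nat. deg \<nu> = n" if \<nu>: "\<nu> \<in> H" for \<nu>
  proof -
    obtain m where "cnj \<nu> * of_real \<rho> * \<nu> = of_int m"
      using pairing[OF \<nu> \<nu>] by blast
    moreover have "cnj \<nu> * of_real \<rho> * \<nu> = of_real ((cmod \<nu>)\<^sup>2 * \<rho>)"
      by (simp add: complex_norm_square del: of_real_power)
    ultimately have "(cmod \<nu>)\<^sup>2 * \<rho> = of_int m"
      by (metis of_real_eq_iff of_real_of_int_eq)
    then have "deg \<nu> = \<bar>of_int m\<bar>"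
      unfolding deg_def by (metis abs_mult abs_power2)
    then have "deg \<nu> = real (nat \<bar>m\<bar>)"
      by simp
    then show ?thesis
      by blast
  qed
  define P where "P = (\<lambda>n::nat. \<exists>\<nu>\<in>H. \<nu> \<noteq> 0 \<and> deg \<nu> = n)"
  have "\<exists>n. P n"
    using iso deg_nat unfolding P_def isogenous_def is_isogeny_def H_def by blast
  then have "P (LEAST n. P n)"
    by (rule LeastI_ex)
  then obtain \<mu> where \<mu>: "\<mu> \<in> H" "\<mu> \<noteq> 0" "deg \<mu> = (LEAST n. P n)"
    unfolding P_def by blast
  define N where "N = (LEAST n. P n)"
  have min: "real N \<le> deg \<nu>" if "\<nu> \<in> H" "\<nu> \<noteq> 0" for \<nu>
  proof -
    obtain n where n: "deg \<nu> = real n"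
      using deg_nat[OF \<open>\<nu> \<in> H\<close>] by blast
    then have "P n"
      unfolding P_def using that by blast
    then have "N \<le> n"
      unfolding N_def by (rule Least_le)
    then show ?thesis
      using n by simp
  qed
  have degN: "deg \<mu> = real N"
    using \<mu>(3) by (simp add: N_def)
  have "deg \<mu> > 0"
    using \<mu>(2) \<rho> by (simp add: deg_def)
  then have "N > 0"
    using degN by simp
  have "\<exists>k. \<nu> = of_int k * \<mu>" if \<nu>: "\<nu> \<in> H" for \<nu>
  proof -
    obtain m where m: "cnj \<mu> * of_real \<rho> * \<nu> = of_int m"
      using pairing[OF \<mu>(1) \<nu>] by blast
    have "of_real ((cmod \<mu>)\<^sup>2 * \<rho>) * \<nu> = \<mu> * (cnj \<mu> * of_real \<rho> * \<nu>)"
      by (simp add: complex_norm_square del: of_real_power)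
    then have *: "of_real ((cmod \<mu>)\<^sup>2 * \<rho>) * \<nu> = of_int m * \<mu>"
      unfolding m by (simp add: mult.commute)
    obtain m' where m': "of_nat N * \<nu> = of_int m' * \<mu>"
    proof (cases "\<rho> > 0")
      case True
      then have "(cmod \<mu>)\<^sup>2 * \<rho> = real N"
        using degN by (simp add: deg_def)
      then show ?thesis
        using that[of m] * by simp
    next
      case False
      then have "(cmod \<mu>)\<^sup>2 * \<rho> = - real N"
        using degN by (simp add: deg_def)
      then have "- (of_nat N * \<nu>) = of_int m * \<mu>"
        using * by simp
      then show ?thesis
        using that[of "- m"] by (simp add: minus_equation_iff[of "of_nat N * \<nu>"])
    qed
    define r where "r = m' mod int N"
    define \<nu>' where "\<nu>' = \<nu> - of_int (m' div int N) * \<mu>"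
    have "\<nu>' \<in> H"
      unfolding \<nu>'_def using H_closed \<nu> \<mu>(1) by blast
    have "of_int m' = of_nat N * of_int (m' div int N) + (of_int r :: complex)"
    proof -
      have "m' = int N * (m' div int N) + r"
        by (simp add: r_def)
      then show ?thesis
        by (metis of_int_add of_int_mult of_int_of_nat_eq)
    qed
    then have \<nu>'N: "of_nat N * \<nu>' = of_int r * \<mu>"
      unfolding \<nu>'_def right_diff_distrib m' by (simp add: algebra_simps)
    \<comment> \<open>From \<open>N * \<nu>' = r * \<mu>\<close> the degree of \<open>\<nu>'\<close>
      is \<open>r\<^sup>2 / N\<close>, which is below the minimum \<open>N\<close>.\<close>
    have "r = 0"
    proof (rule ccontr)
      assume "r \<noteq> 0"
      have "0 \<le> r" "r < int N"
        using \<open>N > 0\<close> by (simp_all add: r_def)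
      have "\<nu>' \<noteq> 0"
        using \<nu>'N \<open>r \<noteq> 0\<close> \<mu>(2) by auto
      have "cmod (of_nat N * \<nu>') = cmod (of_int r * \<mu>)"
        unfolding \<nu>'N ..
      then have "real N * cmod \<nu>' = of_int r * cmod \<mu>"
        using \<open>0 \<le> r\<close> by (simp add: norm_mult)
      then have "(real N * cmod \<nu>')\<^sup>2 * \<bar>\<rho>\<bar> = (of_int r * cmod \<mu>)\<^sup>2 * \<bar>\<rho>\<bar>"
        by simp
      then have "(real N)\<^sup>2 * deg \<nu>' = (of_int r)\<^sup>2 * deg \<mu>"
        by (simp only: deg_def power_mult_distrib mult.assoc)
      moreover have "(real N)\<^sup>2 * deg \<nu>' \<ge> (real N)\<^sup>2 * real N"
        using min[OF \<open>\<nu>' \<in> H\<close> \<open>\<nu>' \<noteq> 0\<close>] by (intro mult_left_mono) auto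
      ultimately have "(real N)\<^sup>2 \<le> (of_int r)\<^sup>2"
        using \<open>N > 0\<close> by (simp add: degN)
      then have "real N \<le> of_int r"
        using \<open>0 \<le> r\<close> by (simp add: power2_le_iff_abs_le)
      then show False
        using \<open>r < int N\<close> by linarith
    qed
    then have "\<nu>' = 0"
      using \<nu>'N \<open>N > 0\<close> by simp
    then show ?thesis
      unfolding \<nu>'_def by auto
  qed
  then show ?thesis
    using that[OF \<mu>(2)] \<mu>(1) unfolding H_def by blast
qed

text \<open>A Smith normal form. Once \<open>e1\<close> is primitive with primitive image,
  \<open>e1\<close> and \<open>\<mu> * e1\<close> both extend to bases, and a single shear makes
  \<open>\<mu>\<close> diagonal.\<close>

lemma lattice_pair_exists:
  assumes o1: "Im (cnj w11 * w12) \<noteq> 0" and o2: "Im (cnj w21 * w22) \<noteq> 0"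
    and CM: "\<not> has_CM (lat w11 w12)" and iso: "isogenous (lat w11 w12) (lat w21 w22)"
  obtains e1 e2 \<mu> d where "lattice_pair e1 e2 \<mu> d" "lat e1 e2 = lat w11 w12"
    "lat (\<mu> * e1) (\<mu> * e2 / of_nat d) = lat w21 w22"
proof -
  obtain \<mu> where \<mu>: "\<mu> \<noteq> 0" and maps: "(\<lambda>z. \<mu> * z) ` lat w11 w12 \<subseteq> lat w21 w22"
    and cyc: "\<And>\<nu>. (\<lambda>z. \<nu> * z) ` lat w11 w12 \<subseteq> lat w21 w22 \<Longrightarrow> \<exists>k. \<nu> = of_int k * \<mu>"
    using hom_cyclic[OF assms] by blast
  have "\<mu> * w11 \<in> lat w21 w22" "\<mu> * w12 \<in> lat w21 w22"
    using maps lat_generators by blast+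
  then obtain p q r s where pq: "\<mu> * w11 = of_int p * w21 + of_int q * w22"
    and rs: "\<mu> * w12 = of_int r * w21 + of_int s * w22"
    unfolding lat_def by blast
  have "p * s - q * r \<noteq> 0"
  proof
    assume "p * s - q * r = 0"
    moreover have "Im (cnj (\<mu> * w11) * (\<mu> * w12)) = of_int (p * s - q * r) * Im (cnj w21 * w22)"
      unfolding pq rs by (simp add: algebra_simps)
    moreover have "cnj (\<mu> * w11) * (\<mu> * w12) = of_real ((cmod \<mu>)\<^sup>2) * (cnj w11 * w12)"
      by (simp add: complex_norm_square del: of_real_power)
    ultimately have "(cmod \<mu>)\<^sup>2 * Im (cnj w11 * w12) = 0"
      by (simp only: Im_of_real_mult of_int_0 mult_zero_left)
    then show False
      using \<mu> o1 by simp
  qed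
  \<comment> \<open>If \<open>l\<close> divided all four entries, \<open>\<mu> / l\<close> would be
    a homomorphism too, hence an integral multiple of the generator \<open>\<mu>\<close>.\<close>
  moreover have "\<not> (int l dvd p \<and> int l dvd q \<and> int l dvd r \<and> int l dvd s)" if l: "prime l" for l :: nat
  proof
    assume "int l dvd p \<and> int l dvd q \<and> int l dvd r \<and> int l dvd s"
    then obtain p' q' r' s' where eqs: "p = int l * p'" "q = int l * q'" "r = int l * r'" "s = int l * s'"
      by (auto elim!: dvdE)
    have l0: "complex_of_nat l \<noteq> 0"
      using l by (simp add: prime_gt_0_nat)
    have gens: "\<mu> / of_nat l * w11 = of_int p' * w21 + of_int q' * w22" "\<mu> / of_nat l * w12 = of_int r' * w21 + of_int s' * w22"
      using pq rs l0 unfolding eqs by (simp_all add: field_simps)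
    have "(\<lambda>z. \<mu> / of_nat l * z) ` lat w11 w12 \<subseteq> lat w21 w22"
      unfolding image_mult_lat gens
      using lat_closed[OF of_int_combination_in_lat of_int_combination_in_lat] by (auto simp: lat_def[of "_ + _" "_ + _"])
    then obtain k where "\<mu> / of_nat l = of_int k * \<mu>"
      using cyc by blast
    then have "of_int (k * int l) * \<mu> = of_int 1 * \<mu>"
      using l0 by (simp add: field_simps)
    then have "k * int l = 1"
      using \<mu> by (simp only: mult_cancel_right of_int_eq_iff) simp
    then show False
      using l by (simp add: zmult_eq_1_iff)
  qed
  ultimately obtain X Y where XY: "coprime X Y" and F: "coprime (p * X + r * Y) (q * X + s * Y)"
    by (rule primitive_matrix_primitive_column)
  obtain U V where UV: "X * V - Y * U = 1"
    by (rule coprime_complete[OF XY])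
  obtain G1 G2 where G: "(p * X + r * Y) * G2 - (q * X + s * Y) * G1 = 1"
    by (rule coprime_complete[OF F])
  define e1 e2' where "e1 = of_int X * w11 + of_int Y * w12" and "e2' = of_int U * w11 + of_int V * w12"
  define g where "g = of_int G1 * w21 + of_int G2 * w22"
  have lat1: "lat e1 e2' = lat w11 w12"
    unfolding e1_def e2'_def by (rule lat_unimodular[OF UV])
  have \<mu>e1: "\<mu> * e1 = of_int (p * X + r * Y) * w21 + of_int (q * X + s * Y) * w22"
  proof -
    have "\<mu> * e1 = of_int X * (\<mu> * w11) + of_int Y * (\<mu> * w12)"
      by (simp add: e1_def algebra_simps)
    then show ?thesis
      unfolding pq rs by (simp add: algebra_simps)
  qed
  have lat2: "lat (\<mu> * e1) g = lat w21 w22"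
    unfolding \<mu>e1 g_def by (rule lat_unimodular[OF G])
  have "\<mu> * e2' \<in> lat (\<mu> * e1) g"
    unfolding lat2 using maps lat_generators[of e2' e1] lat1 by (metis image_subset_iff lat_generators(2))
  then obtain m n where mn: "\<mu> * e2' = of_int m * (\<mu> * e1) + of_int n * g"
    unfolding lat_def by blast
  \<comment> \<open>Subtracting \<open>m * e1\<close> removes the component of
    \<open>\<mu> * e2'\<close> along \<open>\<mu> * e1\<close>; the sign \<open>t\<close> provides
    the orientation required by \<open>lattice_pair\<close>.\<close>
  define t where "t = (if Im (cnj e1 * (e2' - of_int m * e1)) > 0 then 1 else (-1::int))"
  define e2 where "e2 = of_int t * (e2' - of_int m * e1)"
  define d where "d = nat \<bar>n\<bar>"
  have t: "t = 1 \<or> t = -1"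
    by (simp add: t_def)
  have lat1': "lat e1 e2 = lat w11 w12"
    unfolding e2_def lat_shear_sign[OF t] lat1 ..
  have "\<bar>Im (cnj e1 * e2)\<bar> = \<bar>Im (cnj w11 * w12)\<bar>"
    by (rule lat_area_unique[OF lat1' o1])
  then have "Im (cnj e1 * e2) \<noteq> 0"
    using o1 by auto
  moreover have "Im (cnj e1 * e2) = of_int t * Im (cnj e1 * (e2' - of_int m * e1))"
    unfolding e2_def by (simp add: algebra_simps)
  ultimately have pos: "Im (cnj e1 * e2) > 0"
    by (auto simp: t_def split: if_splits)
  have "e2 \<noteq> 0"
    using pos by auto
  have \<mu>e2: "\<mu> * e2 = of_int (t * n) * g"
  proof -
    have "\<mu> * e2 = of_int t * (\<mu> * e2' - of_int m * (\<mu> * e1))"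
      by (simp add: e2_def algebra_simps)
    then show ?thesis
      unfolding mn by simp
  qed
  then have "n \<noteq> 0"
    using \<mu> \<open>e2 \<noteq> 0\<close> by auto
  then have "d > 0"
    by (simp add: d_def)
  \<comment> \<open>The second generator is \<open>g\<close> up to sign, since \<open>d\<close> is
    the absolute value of \<open>n\<close>.\<close>
  have "\<mu> * e2 / of_nat d = of_int (t * sgn n) * (g - of_int 0 * (\<mu> * e1))"
  proof -
    have "n = sgn n * int d"
      by (simp add: d_def mult_sgn_abs)
    then have "complex_of_int n = of_int (sgn n) * of_nat d"
      by (metis of_int_mult of_int_of_nat_eq)
    then show ?thesis
      unfolding \<mu>e2 using \<open>d > 0\<close> by simp
  qed
  moreover have "t * sgn n = 1 \<or> t * sgn n = -1"
    using t \<open>n \<noteq> 0\<close> by (auto simp: sgn_if)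
  ultimately have lat2': "lat (\<mu> * e1) (\<mu> * e2 / of_nat d) = lat w21 w22"
    using lat_shear_sign[of "t * sgn n" "\<mu> * e1" g 0] lat2 by metis
  have "lattice_pair e1 e2 \<mu> d"
    by unfold_locales (use pos \<mu> \<open>d > 0\<close> cyc in \<open>simp_all add: lat1' lat2'\<close>)
  then show ?thesis
    using that lat1' lat2' by blast
qed

theorem mainTheorem13:
  fixes w11 w12 w21 w22 :: complex
  assumes "Im (cnj w11 * w12) \<noteq> 0" and "Im (cnj w21 * w22) \<noteq> 0"
    and "\<not> has_CM (lat w11 w12)" and "\<not> has_CM (lat w21 w22)"
    and "isogenous (lat w11 w12) (lat w21 w22)"
  shows "(\<not> (\<exists>E. irreducible_pp (lat w11 w12 \<times> lat w21 w22)
                   (\<bar>Im (cnj w11 * w12)\<bar> * \<bar>Im (cnj w21 * w22)\<bar>) E))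
         \<longleftrightarrow> (min_isog_deg (lat w11 w12) (lat w21 w22) = 1 \<or>
              (idoneal (min_isog_deg (lat w11 w12) (lat w21 w22)) \<and>
               min_isog_deg (lat w11 w12) (lat w21 w22) mod 8 \<in> {2, 4, 6}))"
proof -
  obtain e1 e2 \<mu> d where "lattice_pair e1 e2 \<mu> d" and lat1: "lat e1 e2 = lat w11 w12"
    and lat2: "lat (\<mu> * e1) (\<mu> * e2 / of_nat d) = lat w21 w22"
    by (rule lattice_pair_exists[OF assms(1,2,3,5)])
  then interpret lattice_pair e1 e2 \<mu> d
    by simp
  have L: "L1 = lat w11 w12" "L2 = lat w21 w22"
    unfolding L1_def L2_def by (simp_all only: lat1 lat2)
  \<comment> \<open>Covolumes do not depend on the basis, so the adapted bases give the same
    normalizing constant as the given ones.\<close>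
  have "area1 = \<bar>Im (cnj w11 * w12)\<bar>" "area2 = \<bar>Im (cnj w21 * w22)\<bar>"
    using lat_area_unique[OF lat1 assms(1)] lat_area_unique[OF lat2 assms(2)] area1_pos area2_pos
    unfolding area1_def area2_def by simp_all
  then show ?thesis
    using no_irreducible_pp_iff unfolding min_isog_deg_eq L[symmetric] by simp
qed

end
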